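(* Fix $p\ge2$, consider the $p$-spin Curie–Weiss model ($J_{i_1\dots i_p}=N^{1-p}$ for all indices), let $\beta=\beta^*_{\mathrm{CW}}(p)$ and $\bm X\sim\mathbb P_\beta$. Let $g(t)=\beta t^p-I(t)$, let $m_*\in(0,1)$ be its unique positive maximizer, and set $\alpha=\big(1+2[(m_*^2-1)g''(m_* )]^{-1/2}\big)^{-1}$ if $p$ is even and $\alpha=\big(1+[(m_*^2-1)g''(m_* )]^{-1/2}\big)^{-1}$ if $p$ is odd. As $N\to\infty$: (1) If $p=2$ (so $\beta=1/2$), then for every $t\in\mathbb R$, $\mathbb P_\beta(N^{1/2}(\hat\beta_N-\frac12)\le t)\to F(\sqrt{6t})-F(-\sqrt{6t})$ for $t\ge0$ and $\to0$ for $t<0$, where $F$ is the distribution function with density proportional to $e^{-t^4/12}$. (2) If $p\ge3$, then $\sqrt N(\hat\beta_N-\beta)\to(1-\alpha)N\big(0,-\frac{g''(m_* )}{p^2m_*^{2p-2}}\big)+\alpha\delta_\infty$ in distribution. (3) (a) If $p\ge4$ is even, $N^{1-p/2}\hat\beta_N\to\alpha\,\mathcal L\big(\frac{1}{pZ^{p-2}}\big)+(1-\alpha)\delta_0$; (b) if $p\ge3$ is odd, $N^{1-p/2}\hat\beta_N\to\frac\alpha2\mathcal L\big(\frac{1}{p|Z|^{p-2}}\big)+\frac\alpha2\delta_\infty+(1-\alpha)\delta_0$, in distribution, where $Z\sim N(0,1)$ and $\mathcal L(Y)$ denotes the law of $Y$.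
   Context: The Curie–Weiss model: $\mathbb P_\beta(\bm X)\propto e^{\beta N\bar X_N^p}$ on $\{-1,1\}^N$, $\bar X_N=N^{-1}\sum_iX_i$ (the $p$-tensor Ising model with $H_N(\bm X)=\sum_{i_1,\dots,i_p}N^{1-p}X_{i_1}\cdots X_{i_p}$). With $m_i(\bm X)=\sum_{i_2,\dots,i_p}N^{1-p}X_{i_2}\cdots X_{i_p}$, the MPL estimate is $\hat\beta_N(\bm X)=\inf\{b\ge0:H_N(\bm X)=\sum_im_i(\bm X)\tanh(pb\,m_i(\bm X))\}$ (inf of empty set $=+\infty$). $I(t)=\frac12[(1+t)\log(1+t)+(1-t)\log(1-t)]$, $\beta^*_{\mathrm{CW}}(p)=\sup\{\beta\ge0:\sup_{t\in[0,1]}(\beta t^p-I(t))=0\}$. Mixtures with $\delta_\infty$ are interpreted as weak convergence on $[-\infty,\infty]$. *)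

theory Defs
  imports "HOL-Probability.Probability" "HOL-Library.FuncSet"
begin

definition conf :: "nat \<Rightarrow> (nat \<Rightarrow> real) set" where
  "conf N = {..<N} \<rightarrow>\<^sub>E {-1, 1}"

definition HN :: "nat \<Rightarrow> nat \<Rightarrow> (nat \<Rightarrow> real) \<Rightarrow> real" where
  "HN p N x = (\<Sum>\<iota>\<in>{..<p} \<rightarrow>\<^sub>E {..<N}. (1 / real N ^ (p - 1)) * (\<Prod>k<p. x (\<iota> k)))"

text \<open>Local fields m_i: sum over (i_2,...,i_p), here indexed by positions 1..p-1.\<close>
definition mloc :: "nat \<Rightarrow> nat \<Rightarrow> (nat \<Rightarrow> real) \<Rightarrow> nat \<Rightarrow> real" where
  "mloc p N x i = (\<Sum>\<iota>\<in>{1..<p} \<rightarrow>\<^sub>E {..<N}. (1 / real N ^ (p - 1)) * (\<Prod>k\<in>{1..<p}. x (\<iota> k)))"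

text \<open>Maximum pseudolikelihood estimate (Inf of empty set = infinity in ereal).\<close>
definition mple :: "nat \<Rightarrow> nat \<Rightarrow> (nat \<Rightarrow> real) \<Rightarrow> ereal" where
  "mple p N x = Inf (ereal ` {b. 0 \<le> b \<and>
       HN p N x = (\<Sum>i<N. mloc p N x i * tanh (real p * b * mloc p N x i))})"

definition cwE :: "nat \<Rightarrow> real \<Rightarrow> nat \<Rightarrow> ((nat \<Rightarrow> real) \<Rightarrow> real) \<Rightarrow> real" where
  "cwE p \<beta> N f = (\<Sum>x\<in>conf N. exp (\<beta> * HN p N x) * f x) / (\<Sum>x\<in>conf N. exp (\<beta> * HN p N x))"

definition cwP :: "nat \<Rightarrow> real \<Rightarrow> nat \<Rightarrow> ((nat \<Rightarrow> real) \<Rightarrow> bool) \<Rightarrow> real" where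
  "cwP p \<beta> N A = cwE p \<beta> N (\<lambda>x. of_bool (A x))"

text \<open>Convergence in distribution on [-infinity, infinity] (weak convergence): for every
  continuous (hence bounded) f on the extended reals, E f(Y_N) tends to L f.\<close>
definition cw_conv_distr :: "nat \<Rightarrow> real \<Rightarrow> (nat \<Rightarrow> (nat \<Rightarrow> real) \<Rightarrow> ereal)
      \<Rightarrow> ((ereal \<Rightarrow> real) \<Rightarrow> real) \<Rightarrow> bool" where
  "cw_conv_distr p \<beta> Y L \<longleftrightarrow>
     (\<forall>f :: ereal \<Rightarrow> real. continuous_on UNIV f \<longrightarrow>
        (\<lambda>N. cwE p \<beta> N (\<lambda>x. f (Y N x))) \<longlonglongrightarrow> L f)"

definition Ient :: "real \<Rightarrow> real" where
  "Ient t = ((1 + t) * ln (1 + t) + (1 - t) * ln (1 - t)) / 2"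

definition betaCW :: "nat \<Rightarrow> real" where
  "betaCW p = Sup {\<beta>. 0 \<le> \<beta> \<and> (SUP t\<in>{0..1}. \<beta> * t ^ p - Ient t) = 0}"

definition gCW :: "nat \<Rightarrow> real \<Rightarrow> real" where
  "gCW p t = betaCW p * t ^ p - Ient t"

definition mstar :: "nat \<Rightarrow> real" where
  "mstar p = (THE m. 0 < m \<and> m < 1 \<and> (\<forall>t\<in>{0..1}. gCW p t \<le> gCW p m))"

definition alphaCW :: "nat \<Rightarrow> real" where
  "alphaCW p = (let s = ((mstar p)\<^sup>2 - 1) * deriv (deriv (gCW p)) (mstar p) in
     if even p then 1 / (1 + 2 / sqrt s) else 1 / (1 + 1 / sqrt s))"

definition Fquart :: "real \<Rightarrow> real" where
  "Fquart x = (\<integral>s. indicator {..x} s * exp (- (s ^ 4) / 12) \<partial>lborel)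
              / (\<integral>s. exp (- (s ^ 4) / 12) \<partial>lborel)"

end

(* With M the mean spin, H_N = N M^p and the local fields all equal M^(p-1), so the estimate is
   artanh M / (p M^(p-1)) when this is nonnegative and infinite otherwise.  Everything reduces to
   the law of M, whose weight at t is, by Stirling's formula, proportional to
   exp (N g(t)) / sqrt (N (1 - t^2)).  At the critical temperature g vanishes exactly at 0 and
   m_* (and at - m_* for even p), so the limit is a mixture over these peaks: near a peak c with
   g(c + u) ~ - A u^r the sum over the lattice is an integral of step functions in
   s = N^(1/r) (M - c), and dominated convergence gives the density exp (- A s^r) with mixture
   weight (1 - c^2)^(-1/2) times its total mass.  Here r = 2, except r = 4 when p = 2.  The
   constant in Stirling's formula cancels between numerator and normalization. *)

theory Submission
  imports Defs "HOL-Real_Asymp.Real_Asymp"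
begin

text \<open>The three laws differ only in what the estimate makes of each peak. At 0 with p >= 3, a
  mean spin M = s / sqrt N gives an estimate of about N^((p-2)/2) / (p s^(p-2)). That is infinite on
  the centered scale and finite after multiplication by N^(1-p/2); for odd p and s < 0, half of the
  mass, no root is admissible. At a positive peak m the estimate is smooth with value beta and slope
  -g''(m) / (p m^(p-1)), while M has variance about -1 / (N g''(m)), so the delta method gives the
  stated variance. For p = 2 the estimate is 1/2 + M^2/6 + ... with M of order N^(-1/4). Two
  obstacles shape the argument. The critical temperature is only a supremum and \<open>mstar\<close>
  only a description, so attainment, uniqueness and strict concavity at the peak have to be proved.
  And the test function depends on N and is evaluated at lattice points, which reach s only in the
  limit; hence its limits are required along every sequence tending to s, but only for almost every
  s, since they may jump at s = 0 or at the boundary of the event.\<close>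

subsection \<open>The entropy function and the critical temperature\<close>

lemma artanh_eq_ln_diff: "\<bar>t\<bar> < 1 \<Longrightarrow> artanh t = (ln (1 + t) - ln (1 - t)) / 2" for t :: real
  by (auto simp: artanh_def ln_div abs_less_iff)

lemma Ient_minus [simp]: "Ient (- t) = Ient t"
  by (simp add: Ient_def)

lemma Ient_0 [simp]: "Ient 0 = 0"
  by (simp add: Ient_def)

lemma Ient_1 [simp]: "Ient 1 = ln 2"
  by (simp add: Ient_def)

lemma has_real_derivative_Ient:
  assumes "\<bar>t\<bar> < 1"
  shows "(Ient has_real_derivative artanh t) (at t within S)"
proof -
  have "((\<lambda>t. ((1 + t) * ln (1 + t) + (1 - t) * ln (1 - t)) / 2) has_real_derivative
        ((1 * ln (1 + t) + 1 / (1 + t) * (1 + t)) + (- 1 * ln (1 - t) + (- 1) / (1 - t) * (1 - t))) / 2)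
        (at t within S)"
    using assms by (auto intro!: derivative_eq_intros)
  moreover have "((1 * ln (1 + t) + 1 / (1 + t) * (1 + t)) + (- 1 * ln (1 - t) + (- 1) / (1 - t) * (1 - t))) / 2
     = artanh t"
    using assms by (auto simp: artanh_eq_ln_diff abs_less_iff)
  ultimately show ?thesis
    by (simp add: Ient_def [abs_def])
qed

text \<open>Only the point 0 has content: there the value is 0 by \<open>ln 0 = 0\<close>, and it
  agrees with the right limit. This carries the continuity of \<open>Ient\<close> up to the
  endpoints.\<close>

lemma continuous_on_mult_ln: "continuous_on {0..} (\<lambda>x::real. x * ln x)"
  unfolding continuous_on_def
proof
  fix x :: real assume "x \<in> {0..}"
  then consider "x = 0" | "x > 0" by force
  then show "((\<lambda>x. x * ln x) \<longlongrightarrow> x * ln x) (at x within {0..})"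
  proof cases
    case 1
    have "((\<lambda>x::real. x * ln x) \<longlongrightarrow> 0) (at_right 0)" by real_asymp
    then show ?thesis using 1 by (simp add: at_within_Ici_at_right)
  next
    case 2
    then show ?thesis by (auto intro!: tendsto_eq_intros)
  qed
qed

lemma continuous_on_Ient: "continuous_on {-1..1} Ient"
proof -
  have "continuous_on {-1..1} (\<lambda>t. ((1 + t) * ln (1 + t) + (1 - t) * ln (1 - t)) / (2::real))"
    by (intro continuous_intros continuous_on_compose2[OF continuous_on_mult_ln]) auto
  then show ?thesis by (simp add: Ient_def [abs_def])
qed

lemma artanh_gt_self:
  assumes "0 < t" "t < 1"
  shows "t < artanh (t::real)"
proof -
  have "artanh 0 - 0 < artanh t - t"
  proof (rule DERIV_pos_imp_increasing_open[OF assms(1)])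
    fix x assume x: "0 < x" "x < t"
    then have "x^2 < 1" "0 < x^2" using assms by (auto simp: power_less_one_iff)
    then have "1 / (1 - x^2) - 1 > 0" by (simp add: field_simps)
    moreover have "((\<lambda>a. artanh a - a) has_real_derivative (1 / (1 - x^2) - 1)) (at x)"
      using x assms by (auto intro!: derivative_eq_intros)
    ultimately show "\<exists>y. ((\<lambda>a. artanh a - a) has_real_derivative y) (at x) \<and> 0 < y" by blast
  next
    show "continuous_on {0..t} (\<lambda>a. artanh a - a)"
      using assms by (auto intro!: continuous_intros)
  qed
  then show ?thesis by simp
qed

text \<open>The derivative of \<open>Ient\<close> is artanh, which exceeds the identity on (0, 1).
  The bound determines the critical value for p = 2 and keeps contact points away from 0 for p >=
  3.\<close>

lemma Ient_gt_half_square_aux: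
  assumes "0 < t" "t \<le> 1"
  shows "t^2 / 2 < Ient t"
proof -
  have "Ient 0 - 0^2/2 < Ient t - t^2/2"
  proof (rule DERIV_pos_imp_increasing_open[OF assms(1)])
    fix x assume x: "0 < x" "x < t"
    have "((\<lambda>a. Ient a - a^2/2) has_real_derivative (artanh x - x)) (at x)"
      using x assms by (auto intro!: derivative_eq_intros has_real_derivative_Ient)
    then show "\<exists>y. ((\<lambda>a. Ient a - a^2/2) has_real_derivative y) (at x) \<and> 0 < y"
      using artanh_gt_self[of x] x assms by force
  next
    show "continuous_on {0..t} (\<lambda>a. Ient a - a^2/2)"
      using assms by (auto intro!: continuous_intros continuous_on_subset[OF continuous_on_Ient])
  qed
  then show ?thesis by simp
qed

lemma Ient_gt_half_square:
  assumes "t \<noteq> 0" "\<bar>t\<bar> \<le> 1"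
  shows "t^2 / 2 < Ient t"
  using Ient_gt_half_square_aux[of t] Ient_gt_half_square_aux[of "-t"] assms by (cases "t > 0") auto

lemma Ient_nonneg: "\<bar>t\<bar> \<le> 1 \<Longrightarrow> 0 \<le> Ient t"
  using Ient_gt_half_square[of t] by (cases "t = 0") (auto intro: order_trans[of _ "t^2/2"])

text \<open>At t = 0 the expression is 0, so its supremum vanishes exactly when no value is
  positive.\<close>

lemma betaCW_alt:
  assumes "p \<ge> 1"
  shows "betaCW p = Sup {\<beta>. 0 \<le> \<beta> \<and> (\<forall>t\<in>{0..1}. \<beta> * t ^ p \<le> Ient t)}"
proof -
  have "(SUP t\<in>{0..1}. \<beta> * t ^ p - Ient t) = 0 \<longleftrightarrow> (\<forall>t\<in>{0..1}. \<beta> * t ^ p \<le> Ient t)"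
    if \<beta>: "0 \<le> \<beta>" for \<beta>
  proof -
    \<comment> \<open>A real supremum bounds its set only if the set is bounded above, so this
      precedes every use of it.\<close>
    have "bdd_above ((\<lambda>t. \<beta> * t ^ p - Ient t) ` {0..1})"
    proof (rule bdd_aboveI2)
      fix t :: real assume t: "t \<in> {0..1}"
      then have "\<beta> * t^p \<le> \<beta> * 1" using \<beta> by (intro mult_left_mono power_le_one) auto
      moreover have "0 \<le> Ient t" using t by (intro Ient_nonneg) auto
      ultimately show "\<beta> * t ^ p - Ient t \<le> \<beta>" by simp
    qed
    note bdd = this
    have z: "\<beta> * 0 ^ p - Ient 0 = 0" using assms by simp
    show ?thesis
    proof
      assume *: "(SUP t\<in>{0..1}. \<beta> * t ^ p - Ient t) = 0"
      show "\<forall>t\<in>{0..1}. \<beta> * t ^ p \<le> Ient t"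
        using cSUP_upper[OF _ bdd] * by fastforce
    next
      assume *: "\<forall>t\<in>{0..1}. \<beta> * t ^ p \<le> Ient t"
      show "(SUP t\<in>{0..1}. \<beta> * t ^ p - Ient t) = 0"
      proof (rule antisym)
        show "(SUP t\<in>{0..1}. \<beta> * t ^ p - Ient t) \<le> 0"
          using * by (intro cSUP_least) auto
        show "0 \<le> (SUP t\<in>{0..1}. \<beta> * t ^ p - Ient t)"
          using cSUP_upper[OF _ bdd, of 0] unfolding z by simp
      qed
    qed
  qed
  then show ?thesis unfolding betaCW_def by (metis (mono_tags, lifting))
qed

lemma betaCW_2: "betaCW 2 = 1/2"
proof -
  have "{\<beta>. 0 \<le> \<beta> \<and> (\<forall>t\<in>{0..1}. \<beta> * t ^ 2 \<le> Ient t)} = {0..1/2}"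
  proof (intro equalityI subsetI)
    fix \<beta> assume "\<beta> \<in> {\<beta>. 0 \<le> \<beta> \<and> (\<forall>t\<in>{0..1}. \<beta> * t ^ 2 \<le> Ient t)}"
    then have b: "0 \<le> \<beta>" "\<And>t. t \<in> {0..1} \<Longrightarrow> \<beta> * t ^ 2 \<le> Ient t" by auto
    \<comment> \<open>The constraint is sharpest as t tends to 0, where the quotient tends to 1/2
      without reaching it.\<close>
    have "((\<lambda>t. Ient t / t^2) \<longlongrightarrow> 1/2) (at_right 0)"
      unfolding Ient_def by real_asymp
    moreover have "eventually (\<lambda>t. \<beta> \<le> Ient t / t^2) (at_right 0)"
      using eventually_at_right_real[of 0 "1::real", OF zero_less_one]
    proof eventually_elim
      case (elim x)
      then show ?case using b(2)[of x] by (simp add: field_simps)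
    qed
    ultimately have "\<beta> \<le> 1/2"
      by (rule tendsto_lowerbound) simp
    then show "\<beta> \<in> {0..1/2}" using b by simp
  next
    fix \<beta> :: real assume b: "\<beta> \<in> {0..1/2}"
    have "\<beta> * t^2 \<le> Ient t" if "t \<in> {0..1}" for t
    proof -
      have "\<beta> * t^2 \<le> 1/2 * t^2" using b by (intro mult_right_mono) auto
      also have "\<dots> \<le> Ient t" using Ient_gt_half_square[of t] that by (cases "t = 0") auto
      finally show ?thesis .
    qed
    then show "\<beta> \<in> {\<beta>. 0 \<le> \<beta> \<and> (\<forall>t\<in>{0..1}. \<beta> * t ^ 2 \<le> Ient t)}" using b by auto
  qed
  then show ?thesis by (simp add: betaCW_alt)
qed

text \<open>Since artanh is unbounded at 1, the difference \<open>\<beta> * t ^ p - Ient t\<close>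
  strictly decreases just before 1. Equality at 1 would make it positive slightly to the left. This
  excludes 1 as a maximizer.\<close>

lemma Ient_1_gt:
  assumes p: "p \<ge> 1" and le: "\<And>t. t \<in> {0..1} \<Longrightarrow> \<beta> * t ^ p \<le> Ient t" and "0 \<le> \<beta>"
  shows "\<beta> < Ient 1"
proof -
  have "eventually (\<lambda>x. artanh x > real p * \<beta>) (at_left (1::real))"
    using artanh_real_at_left_1 by (auto simp: filterlim_at_top_dense)
  moreover have "eventually (\<lambda>x. x \<in> {0<..<1}) (at_left (1::real))"
    by (rule eventually_at_left_real) simp
  ultimately have "eventually (\<lambda>x. artanh x > real p * \<beta> \<and> x \<in> {0<..<1}) (at_left (1::real))"
    by eventually_elim auto
  then obtain b where b: "b < 1" "\<And>x. b < x \<Longrightarrow> x < 1 \<Longrightarrow> artanh x > real p * \<beta> \<and> x \<in> {0<..<1}"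
    by (auto simp: eventually_at_left_field)
  obtain s where s: "b < s" "s < 1" using dense[OF b(1)] by blast
  have "\<beta> * 1^p - Ient 1 < \<beta> * s^p - Ient s"
  proof (rule DERIV_neg_imp_decreasing_open[OF s(2)])
    fix x assume x: "s < x" "x < 1"
    then have x': "artanh x > real p * \<beta>" "x \<in> {0<..<1}" using b(2)[of x] s by auto
    have "((\<lambda>a. \<beta> * a^p - Ient a) has_real_derivative (\<beta> * (real p * x^(p-1)) - artanh x)) (at x)"
      using x' by (auto intro!: derivative_eq_intros has_real_derivative_Ient)
    moreover have "\<beta> * (real p * x^(p-1)) \<le> \<beta> * (real p * 1)"
      using x' assms by (intro mult_left_mono power_le_one) auto
    then have "\<beta> * (real p * x^(p-1)) - artanh x < 0" using x' by (simp add: mult.commute)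
    ultimately show "\<exists>y. ((\<lambda>a. \<beta> * a^p - Ient a) has_real_derivative y) (at x) \<and> y < 0" by blast
  next
    show "continuous_on {s..1} (\<lambda>a. \<beta> * a^p - Ient a)"
      using b(2)[OF s] by (auto intro!: continuous_intros continuous_on_subset[OF continuous_on_Ient])
  qed
  then show ?thesis using le[of s] b(2)[OF s] by simp
qed

text \<open>The critical value is the minimum of \<open>Ient t / t ^ p\<close>. Compactness gives a
  minimum c on [1/2, 1]; below 1/2 the constraint with slope c holds because of the quadratic bound
  on the entropy.\<close>

lemma betaCW_attained:
  assumes p: "p \<ge> 3"
  obtains m where "0 < m" "m < 1" "betaCW p * m ^ p = Ient m" "0 < betaCW p"
    "\<And>t. t \<in> {0..1} \<Longrightarrow> betaCW p * t ^ p \<le> Ient t"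
proof -
  have "continuous_on {1/2..1} (\<lambda>t. Ient t / t ^ p)"
    by (auto intro!: continuous_intros continuous_on_subset[OF continuous_on_Ient])
  then obtain m where m: "m \<in> {1/2..1}" "\<And>t. t \<in> {1/2..1} \<Longrightarrow> Ient m / m ^ p \<le> Ient t / t ^ p"
    using continuous_attains_inf[of "{1/2..1::real}" "\<lambda>t. Ient t / t ^ p"] by auto
  define c where "c = Ient m / m ^ p"
  \<comment> \<open>The value at t = 1 is ln 2 < 1; this bound on c is what the comparison below 1/2
    uses.\<close>
  have c1: "c \<le> 1" using m(2)[of 1] ln_2_less_1 by (simp add: c_def)
  have m0: "0 < m" using m by auto
  have Im: "Ient m > 0" using Ient_gt_half_square[of m] m by (auto intro: le_less_trans[of _ "m^2/2"])
  have c0: "0 < c" using Im m0 by (simp add: c_def)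
  have le: "c * t ^ p \<le> Ient t" if t: "t \<in> {0..1}" for t
  proof (cases "t \<ge> 1/2")
    case True
    then have "c \<le> Ient t / t^p" unfolding c_def using t m(2)[of t] by simp
    then show ?thesis using True by (simp add: field_simps)
  next
    case False
    \<comment> \<open>One factor t yields the 1/2 and two are kept for \<open>t^2/2\<close>; having
      three factors is where p >= 3 enters.\<close>
    have "t ^ p = t * t ^ 2 * t ^ (p - 3)"
      using p power_add[of t 3 "p - 3"] by (simp add: power3_eq_cube power2_eq_square)
    also have "\<dots> \<le> (1/2) * t^2 * 1"
      using t False by (intro mult_mono power_le_one) auto
    finally have "t ^ p \<le> t^2/2" by simp
    then have "c * t^p \<le> 1 * (t^2/2)" using c1 c0 t by (intro mult_mono) auto
    also have "\<dots> \<le> Ient t" using Ient_gt_half_square[of t] t by (cases "t = 0") auto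
    finally show ?thesis .
  qed
  have "{\<beta>. 0 \<le> \<beta> \<and> (\<forall>t\<in>{0..1}. \<beta> * t ^ p \<le> Ient t)} = {0..c}"
  proof (intro equalityI subsetI)
    fix \<beta> assume "\<beta> \<in> {\<beta>. 0 \<le> \<beta> \<and> (\<forall>t\<in>{0..1}. \<beta> * t ^ p \<le> Ient t)}"
    then show "\<beta> \<in> {0..c}" using m by (auto simp: c_def field_simps m0)
  next
    fix \<beta> assume "\<beta> \<in> {0..c}"
    then have "\<beta> * t^p \<le> c * t^p" if "t \<in> {0..1}" for t
      using that by (intro mult_right_mono) auto
    then show "\<beta> \<in> {\<beta>. 0 \<le> \<beta> \<and> (\<forall>t\<in>{0..1}. \<beta> * t ^ p \<le> Ient t)}"
      using le \<open>\<beta> \<in> {0..c}\<close> by force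
  qed
  then have beta: "betaCW p = c"
    using betaCW_alt[of p] p c0 by simp
  have eq: "c * m ^ p = Ient m" using m0 by (simp add: c_def)
  have "m \<noteq> 1" using Ient_1_gt[of p c] le c0 p eq by fastforce
  then have "m < 1" using m by auto
  show thesis by (rule that[of m]) (use beta m0 \<open>m < 1\<close> eq c0 le in auto)
qed

subsection \<open>The maximizers of the rate function\<close>

lemma gCW_minus_even: "even p \<Longrightarrow> gCW p (- t) = gCW p t"
  by (simp add: gCW_def)

lemma gCW_0 [simp]: "p \<ge> 1 \<Longrightarrow> gCW p 0 = 0"
  by (simp add: gCW_def)

lemma continuous_on_gCW: "continuous_on {-1..1} (gCW p)"
  unfolding gCW_def [abs_def] by (intro continuous_intros continuous_on_Ient)

lemma has_real_derivative_gCW: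
  assumes "\<bar>t\<bar> < 1"
  shows "(gCW p has_real_derivative (real p * betaCW p * t ^ (p - 1) - artanh t)) (at t)"
  unfolding gCW_def [abs_def] using assms
  by (auto intro!: derivative_eq_intros has_real_derivative_Ient)

lemma deriv_gCW: "\<bar>t\<bar> < 1 \<Longrightarrow> deriv (gCW p) t = real p * betaCW p * t ^ (p - 1) - artanh t"
  by (rule DERIV_imp_deriv [OF has_real_derivative_gCW])

lemma has_real_derivative_deriv_gCW:
  assumes "\<bar>t\<bar> < 1"
  shows "(deriv (gCW p) has_real_derivative
           (real p * betaCW p * (real (p - 1) * t ^ (p - 2)) - 1 / (1 - t^2))) (at t)"
proof -
  have "((\<lambda>t. real p * betaCW p * t ^ (p - 1) - artanh t) has_real_derivative
           (real p * betaCW p * (real (p - 1) * t ^ (p - 2)) - 1 / (1 - t^2))) (at t)"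
    using assms by (auto intro!: derivative_eq_intros simp: numeral_2_eq_2)
  moreover have "eventually (\<lambda>x. x \<in> {-1<..<1}) (nhds t)"
    using assms by (intro eventually_nhds_in_open) auto
  then have "eventually (\<lambda>x. deriv (gCW p) x = real p * betaCW p * x ^ (p - 1) - artanh x) (nhds t)"
    by eventually_elim (subst deriv_gCW, auto simp: abs_less_iff)
  ultimately show ?thesis by (subst DERIV_cong_ev) auto
qed

lemma deriv2_gCW:
  "\<bar>t\<bar> < 1 \<Longrightarrow> deriv (deriv (gCW p)) t = real p * betaCW p * (real (p - 1) * t ^ (p - 2)) - 1 / (1 - t^2)"
  by (rule DERIV_imp_deriv [OF has_real_derivative_deriv_gCW])

text \<open>This is t^p times the derivative of artanh t / t^(p-1). The positive critical points of
  \<open>gCW p\<close> are the points where that quotient equals p times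
  \<open>betaCW p\<close>.\<close>

definition tiltSlope :: "nat \<Rightarrow> real \<Rightarrow> real" where
  "tiltSlope p t = t / (1 - t^2) - real (p - 1) * artanh t"

lemma has_real_derivative_tiltSlope:
  assumes "\<bar>t\<bar> < 1" "p \<ge> 1"
  shows "(tiltSlope p has_real_derivative ((real p * t^2 - (real p - 2)) / (1 - t^2)^2)) (at t)"
proof -
  have nz: "1 - t^2 \<noteq> 0" using assms abs_square_eq_1[of t] by auto
  have "(tiltSlope p has_real_derivative
      ((1 * (1 - t^2) - t * (- (2 * t))) / ((1 - t^2) * (1 - t^2)) - real (p - 1) * (1 / (1 - t^2)))) (at t)"
    unfolding tiltSlope_def [abs_def] using assms nz
    by (auto intro!: derivative_eq_intros)
  moreover have "((1 * (1 - t^2) - t * (- (2 * t))) / ((1 - t^2) * (1 - t^2)) - real (p - 1) * (1 / (1 - t^2)))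
      = (real p * t^2 - (real p - 2)) / (1 - t^2)^2"
    using nz assms by (simp add: divide_simps of_nat_diff) (simp add: algebra_simps power2_eq_square)
  ultimately show ?thesis by simp
qed

lemma has_real_derivative_artanh_div_power:
  assumes "0 < t" "t < 1" "p \<ge> 2"
  shows "((\<lambda>t. artanh t / t ^ (p - 1)) has_real_derivative (tiltSlope p t / t ^ p)) (at t)"
proof -
  have nz: "1 - t^2 \<noteq> 0" using assms abs_square_eq_1[of t] by auto
  have "((\<lambda>t. artanh t / t ^ (p - 1)) has_real_derivative
      ((1 / (1 - t^2) * t ^ (p-1) - artanh t * (real (p - 1) * t ^ (p - 2)))
        / (t ^ (p-1) * t ^ (p-1)))) (at t)"
    using assms by (auto intro!: derivative_eq_intros simp: numeral_2_eq_2)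
  moreover obtain q where q: "p = Suc (Suc q)"
    using assms by (metis add_2_eq_Suc le_Suc_ex)
  have "((1 / (1 - t^2) * t ^ (p-1) - artanh t * (real (p - 1) * t ^ (p - 2)))
        / (t ^ (p-1) * t ^ (p-1))) = tiltSlope p t / t ^ p"
    using assms nz by (simp add: tiltSlope_def q divide_simps) (simp add: algebra_simps)
  ultimately show ?thesis by simp
qed

text \<open>Rolle's theorem, applied to \<open>gCW p\<close>, then to \<open>artanh t / t ^ (p - 1)\<close> and then to
  \<open>tiltSlope p\<close>, places the zero of \<open>tiltSlope p\<close> to the left of every positive
  maximizer.\<close>

lemma tiltSlope_pos:
  assumes p: "p \<ge> 3" and m: "0 < m" "m < 1" and zero: "gCW p m = 0"
    and le: "\<And>t. t \<in> {0..1} \<Longrightarrow> gCW p t \<le> 0" and t: "m \<le> t" "t < 1"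
  shows "tiltSlope p t > 0" "artanh m / m ^ (p - 1) = real p * betaCW p"
proof -
  have crit: "artanh x / x ^ (p - 1) = real p * betaCW p"
    if x: "0 < x" "x < 1" "real p * betaCW p * x ^ (p - 1) - artanh x = 0" for x
    using x by (simp add: field_simps)
  have "real p * betaCW p * m ^ (p - 1) - artanh m = 0"
  proof (rule DERIV_local_max)
    show "(gCW p has_real_derivative (real p * betaCW p * m ^ (p - 1) - artanh m)) (at m)"
      using m by (intro has_real_derivative_gCW) auto
    \<comment> \<open>This radius keeps the neighbourhood inside [0, 1], where the sign of
      \<open>gCW p\<close> is known.\<close>
    show "0 < min m (1 - m)" using m by auto
    show "\<forall>y. \<bar>m - y\<bar> < min m (1 - m) \<longrightarrow> gCW p y \<le> gCW p m"
      using zero le m by (auto simp: abs_less_iff)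
  qed
  then show hm: "artanh m / m ^ (p - 1) = real p * betaCW p" using crit m by auto
  obtain c where c: "0 < c" "c < m" "real p * betaCW p * c ^ (p - 1) - artanh c = 0"
  proof -
    have "\<exists>z>0. z < m \<and> (*) (real p * betaCW p * z ^ (p - 1) - artanh z) = (\<lambda>v. 0)"
    proof (rule Rolle_deriv[where f = "gCW p"])
      show "0 < m" "gCW p 0 = gCW p m" using m zero p by auto
      show "continuous_on {0..m} (gCW p)"
        using m by (intro continuous_on_subset[OF continuous_on_gCW]) auto
      show "(gCW p has_derivative (*) (real p * betaCW p * x ^ (p - 1) - artanh x)) (at x)"
        if "0 < x" "x < m" for x
        using has_real_derivative_gCW[of x p] that m by (auto simp: has_field_derivative_def)
    qed
    then show ?thesis using that by (metis mult.right_neutral)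
  qed
  have hc: "artanh c / c ^ (p - 1) = real p * betaCW p" using crit c m by auto
  obtain d where d: "c < d" "d < m" "tiltSlope p d = 0"
  proof -
    have "\<exists>z>c. z < m \<and> (*) (tiltSlope p z / z ^ p) = (\<lambda>v. 0)"
    proof (rule Rolle_deriv[where f = "\<lambda>t. artanh t / t ^ (p - 1)"])
      show "c < m" by fact
      show "artanh c / c ^ (p - 1) = artanh m / m ^ (p - 1)" using hc hm by simp
      show "continuous_on {c..m} (\<lambda>t. artanh t / t ^ (p - 1))"
        using c m by (intro continuous_intros) auto
      show "((\<lambda>t. artanh t / t ^ (p - 1)) has_derivative (*) (tiltSlope p x / x ^ p)) (at x)"
        if "c < x" "x < m" for x
        using has_real_derivative_artanh_div_power[of x p] that m c p
        by (auto simp: has_field_derivative_def)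
    qed
    then obtain z where z: "z > c" "z < m" "(*) (tiltSlope p z / z ^ p) = (\<lambda>v. 0)" by blast
    have "tiltSlope p z / z ^ p = 0" using fun_cong[OF z(3), of 1] by simp
    then show ?thesis using that[of z] z c by auto
  qed
  obtain e where e: "0 < e" "e < d" "real p * e^2 - (real p - 2) = 0"
  proof -
    have "\<exists>z>0. z < d \<and> (*) ((real p * z^2 - (real p - 2)) / (1 - z^2)^2) = (\<lambda>v. 0)"
    proof (rule Rolle_deriv[where f = "tiltSlope p"])
      show "0 < d" using c d by simp
      show "tiltSlope p 0 = tiltSlope p d" using d by (simp add: tiltSlope_def)
      show "(tiltSlope p has_derivative (*) ((real p * x^2 - (real p - 2)) / (1 - x^2)^2)) (at x)"
        if "0 < x" "x < d" for x
        using has_real_derivative_tiltSlope[of x p] that m c d p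
        by (auto simp: has_field_derivative_def)
      have "isCont (tiltSlope p) x" if "x \<in> {0..d}" for x
        using has_real_derivative_tiltSlope[of x p] that m c d p by (auto intro!: DERIV_isCont)
      then show "continuous_on {0..d} (tiltSlope p)" by (auto intro!: continuous_at_imp_continuous_on)
    qed
    then obtain z where z: "z > 0" "z < d" "(*) ((real p * z^2 - (real p - 2)) / (1 - z^2)^2) = (\<lambda>v. 0)"
      by blast
    have "(real p * z^2 - (real p - 2)) / (1 - z^2)^2 = 0" using fun_cong[OF z(3), of 1] by simp
    moreover have "1 - z^2 \<noteq> 0" using z d m abs_square_eq_1[of z] by auto
    ultimately have "real p * z^2 - (real p - 2) = 0" by simp
    then show ?thesis using that z by auto
  qed
  \<comment> \<open>For positive x the numerator of the derivative increases in x and vanishes at e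
    < d, so \<open>tiltSlope p\<close> increases from its zero d onwards.\<close>
  have "tiltSlope p d < tiltSlope p t"
  proof (rule DERIV_pos_imp_increasing_open[where f = "tiltSlope p"])
    show "d < t" using d t by simp
    show "\<exists>y. (tiltSlope p has_real_derivative y) (at x) \<and> 0 < y" if x: "d < x" "x < t" for x
    proof (intro exI conjI)
      show "(tiltSlope p has_real_derivative ((real p * x^2 - (real p - 2)) / (1 - x^2)^2)) (at x)"
        using x c d t p by (intro has_real_derivative_tiltSlope) auto
      have "real p * e^2 < real p * x^2"
        using e x p by (intro mult_strict_left_mono power_strict_mono) auto
      moreover have "1 - x^2 \<noteq> 0" using x c d t abs_square_eq_1[of x] by auto
      ultimately show "0 < (real p * x^2 - (real p - 2)) / (1 - x^2)^2" using e by auto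
    qed
    have "isCont (tiltSlope p) x" if "x \<in> {d..t}" for x
      using has_real_derivative_tiltSlope[of x p] that t c d p by (auto intro!: DERIV_isCont)
    then show "continuous_on {d..t} (tiltSlope p)" by (auto intro!: continuous_at_imp_continuous_on)
  qed
  then show "tiltSlope p t > 0" using d by simp
qed

text \<open>Two zeros of \<open>gCW p\<close> in (0, 1) would both be critical, hence give the same
  value of artanh t / t^(p-1). But that quotient strictly increases to the right of any such zero,
  because \<open>tiltSlope p\<close> is positive there.\<close>

lemma mstar_properties:
  assumes p: "p \<ge> 3"
  shows "0 < mstar p" "mstar p < 1" "gCW p (mstar p) = 0"
    "deriv (gCW p) (mstar p) = 0" "deriv (deriv (gCW p)) (mstar p) < 0"
    "artanh (mstar p) / mstar p ^ (p - 1) = real p * betaCW p"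
    "tiltSlope p (mstar p) = - (mstar p * deriv (deriv (gCW p)) (mstar p))"
    "0 < betaCW p"
    "\<And>t. t \<in> {0..1} \<Longrightarrow> t \<noteq> 0 \<Longrightarrow> t \<noteq> mstar p \<Longrightarrow> gCW p t < 0"
proof -
  obtain m where m: "0 < m" "m < 1" "betaCW p * m ^ p = Ient m" "0 < betaCW p"
    "\<And>t. t \<in> {0..1} \<Longrightarrow> betaCW p * t ^ p \<le> Ient t"
    using betaCW_attained[OF p] by blast
  have g0: "gCW p m = 0" using m by (simp add: gCW_def)
  have le: "gCW p t \<le> 0" if "t \<in> {0..1}" for t using m(5)[OF that] by (simp add: gCW_def)
  have less: "x = y" if xy: "x \<le> y" "0 < x" "y < 1" "gCW p x = 0" "gCW p y = 0" for x y
  proof (rule ccontr)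
    assume "x \<noteq> y"
    then have "x < y" using xy by simp
    then have "artanh x / x ^ (p - 1) < artanh y / y ^ (p - 1)"
    proof (rule DERIV_pos_imp_increasing_open[where f = "\<lambda>t. artanh t / t ^ (p - 1)"])
      show "\<exists>d. ((\<lambda>t. artanh t / t ^ (p - 1)) has_real_derivative d) (at z) \<and> 0 < d"
        if z: "x < z" "z < y" for z
        using has_real_derivative_artanh_div_power[of z p] tiltSlope_pos(1)[OF p, of x z] z xy le p
        by (intro exI[of _ "tiltSlope p z / z ^ p"]) auto
      show "continuous_on {x..y} (\<lambda>t. artanh t / t ^ (p - 1))"
        using xy by (intro continuous_intros) auto
    qed
    moreover have "artanh x / x ^ (p - 1) = real p * betaCW p" "artanh y / y ^ (p - 1) = real p * betaCW p"
      using tiltSlope_pos(2)[OF p, of x x] tiltSlope_pos(2)[OF p, of y y] xy le by auto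
    ultimately show False by simp
  qed
  have uniq: "x = m" if "0 < x" "x < 1" "gCW p x = 0" for x
    using less[of x m] less[of m x] that m g0 by linarith
  have ms: "mstar p = m" unfolding mstar_def
  proof (rule the_equality)
    show "0 < m \<and> m < 1 \<and> (\<forall>t\<in>{0..1}. gCW p t \<le> gCW p m)" using m(1,2) le g0 by auto
  next
    fix x assume x: "0 < x \<and> x < 1 \<and> (\<forall>t\<in>{0..1}. gCW p t \<le> gCW p x)"
    then have "gCW p m \<le> gCW p x" using m(1,2) by simp
    then show "x = m" using g0 x le[of x] uniq[of x] by auto
  qed
  show "0 < mstar p" "mstar p < 1" "gCW p (mstar p) = 0" "0 < betaCW p" using m(1,2,4) g0 ms by auto
  have T: "tiltSlope p m > 0" and h: "artanh m / m ^ (p - 1) = real p * betaCW p"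
    using tiltSlope_pos[OF p m(1,2) g0 le, of m] m(2) by auto
  show "artanh (mstar p) / mstar p ^ (p - 1) = real p * betaCW p" using h ms by simp
  have h': "artanh m = real p * betaCW p * m ^ (p - 1)" using h m(1) by (simp add: field_simps)
  then show "deriv (gCW p) (mstar p) = 0" using m(1,2) ms by (simp add: deriv_gCW)
  obtain q where q: "p = Suc (Suc q)"
    using p le_Suc_ex[of 2 p] by auto
  have nz: "1 - m^2 \<noteq> 0" using m(1,2) abs_square_eq_1[of m] by auto
  \<comment> \<open>The critical equation eliminates artanh m and turns \<open>tiltSlope p m\<close>
    into -m g''(m). Strict positivity of the former is therefore nondegeneracy of the peak.\<close>
  show *: "tiltSlope p (mstar p) = - (mstar p * deriv (deriv (gCW p)) (mstar p))"
    unfolding tiltSlope_def ms h' using m(1,2) by (subst deriv2_gCW) (auto simp: q algebra_simps)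
  show "deriv (deriv (gCW p)) (mstar p) < 0" using * T m(1) by (simp add: ms mult_less_0_iff)
  fix t :: real assume t: "t \<in> {0..1}" "t \<noteq> 0" "t \<noteq> mstar p"
  show "gCW p t < 0"
  \<comment> \<open>Uniqueness of the zero covers only the open interval, so the endpoint is treated
    by itself.\<close>
  proof (cases "t = 1")
    case True
    then show ?thesis using Ient_1_gt[of p "betaCW p"] m(4,5) p by (simp add: gCW_def)
  next
    case False
    then show ?thesis using uniq[of t] le[of t] t ms by force
  qed
qed

lemma gCW_2_neg: "t \<noteq> 0 \<Longrightarrow> \<bar>t\<bar> \<le> 1 \<Longrightarrow> gCW 2 t < 0"
  using Ient_gt_half_square[of t] by (simp add: gCW_def betaCW_2)

lemma gCW_neg_odd:
  assumes "odd p" "p \<ge> 3" "-1 \<le> t" "t < 0"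
  shows "gCW p t < 0"
proof -
  have "0 < Ient t" using assms by (intro le_less_trans[OF _ Ient_gt_half_square[of t]]) auto
  moreover have "betaCW p * t ^ p \<le> 0"
    using assms mstar_properties(8)[of p] by (simp add: mult_le_0_iff power_less_zero_eq less_imp_le)
  ultimately show ?thesis by (simp add: gCW_def)
qed

subsection \<open>Local expansions of the rate function\<close>

text \<open>The entropy is t^2/2 + t^4/12 + ..., and at inverse temperature 1/2 the quadratic terms
  cancel. The form \<open>0 + u\<close> fits the pattern of an expansion at a general peak
  c.\<close>

lemma gCW_2_expansion: "((\<lambda>u. gCW 2 (0 + u) / u ^ 4) \<longlongrightarrow> - (1/12)) (at 0)"
proof -
  have "((\<lambda>u. (1/2 * u^2 - ((1 + u) * ln (1 + u) + (1 - u) * ln (1 - u)) / 2) / u ^ 4) \<longlongrightarrow> - (1/12)) (at_right (0::real))"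
    by real_asymp
  moreover have "((\<lambda>u. (1/2 * u^2 - ((1 + u) * ln (1 + u) + (1 - u) * ln (1 - u)) / 2) / u ^ 4) \<longlongrightarrow> - (1/12)) (at_left (0::real))"
    by real_asymp
  ultimately show ?thesis by (simp add: gCW_def betaCW_2 Ient_def filterlim_split_at)
qed

text \<open>For p >= 3 the monomial is of higher order than u^2, so the curvature at 0 is that of
  the entropy alone.\<close>

lemma gCW_expansion_0:
  assumes "p \<ge> 3"
  shows "((\<lambda>u. gCW p (0 + u) / u ^ 2) \<longlongrightarrow> - (1/2)) (at 0)"
proof -
  have "((\<lambda>u. ((1 + u) * ln (1 + u) + (1 - u) * ln (1 - u)) / 2 / u ^ 2) \<longlongrightarrow> 1/2) (at_right (0::real))"
    by real_asymp
  moreover have "((\<lambda>u. ((1 + u) * ln (1 + u) + (1 - u) * ln (1 - u)) / 2 / u ^ 2) \<longlongrightarrow> 1/2) (at_left (0::real))"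
    by real_asymp
  ultimately have I: "((\<lambda>u. Ient u / u ^ 2) \<longlongrightarrow> 1/2) (at 0)"
    by (simp add: Ient_def filterlim_split_at)
  have "((\<lambda>u. betaCW p * u ^ (p - 2) - Ient u / u ^ 2) \<longlongrightarrow> betaCW p * 0 ^ (p - 2) - 1/2) (at 0)"
    by (intro tendsto_intros I)
  also have "betaCW p * 0 ^ (p - 2) - 1/2 = - (1/2)"
    using assms by (simp add: power_0_left)
  also have "((\<lambda>u. betaCW p * u ^ (p - 2) - Ient u / u ^ 2) \<longlongrightarrow> - (1/2)) (at 0) \<longleftrightarrow> ?thesis"
  proof (rule filterlim_cong[OF refl refl])
    have "u ^ p = u ^ (p - 2) * u ^ 2" for u :: real
    proof -
      obtain q where "p = q + 2" using assms by (intro that[of "p - 2"]) simp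
      then show ?thesis by (simp add: power2_eq_square ac_simps)
    qed
    then show "eventually (\<lambda>u. betaCW p * u ^ (p - 2) - Ient u / u ^ 2 = gCW p (0 + u) / u ^ 2) (at 0)"
      by (auto simp: eventually_at_filter gCW_def field_simps)
  qed
  finally show ?thesis .
qed

text \<open>One use of l'Hopital leaves half the difference quotient of g' at the peak. As g'
  vanishes there, its limit is g'' by definition.\<close>

lemma gCW_expansion_mstar:
  assumes p: "p \<ge> 3"
  shows "((\<lambda>u. gCW p (mstar p + u) / u ^ 2) \<longlongrightarrow> - (- deriv (deriv (gCW p)) (mstar p) / 2)) (at 0)"
proof (rule lhopital)
  let ?m = "mstar p"
  note P = mstar_properties[OF p]
  have ev: "eventually (\<lambda>u. ?m + u \<in> {-1<..<1}) (at 0)"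
  proof -
    have "((\<lambda>u. ?m + u) \<longlongrightarrow> ?m + 0) (at 0)" by (intro tendsto_intros)
    then show ?thesis using P by (intro topological_tendstoD) auto
  qed
  have D: "((\<lambda>u. gCW p (?m + u)) has_real_derivative deriv (gCW p) (?m + u)) (at u)"
    if "?m + u \<in> {-1<..<1}" for u
    using DERIV_shift[of "gCW p" "deriv (gCW p) (u + ?m)" u ?m] has_real_derivative_gCW[of "u + ?m" p]
      deriv_gCW[of "u + ?m" p] that by (simp add: add.commute abs_less_iff)
  have "isCont (\<lambda>u. gCW p (?m + u)) 0"
    using D[of 0] P by (intro DERIV_isCont) auto
  then show "((\<lambda>u. gCW p (?m + u)) \<longlongrightarrow> 0) (at 0)"
    using P by (simp add: isCont_def)
  show "((\<lambda>u::real. u\<^sup>2) \<longlongrightarrow> 0) (at 0)"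
    by (auto intro!: tendsto_eq_intros)
  show "eventually (\<lambda>u::real. u^2 \<noteq> 0) (at 0)" "eventually (\<lambda>u::real. 2 * u \<noteq> 0) (at 0)"
    by (auto simp: eventually_at_filter)
  show "eventually (\<lambda>u. ((\<lambda>u. gCW p (?m + u)) has_real_derivative deriv (gCW p) (?m + u)) (at u)) (at 0)"
    using ev by eventually_elim (rule D)
  show "eventually (\<lambda>u. ((\<lambda>u::real. u\<^sup>2) has_real_derivative 2 * u) (at u)) (at 0)"
    by (auto intro!: always_eventually derivative_eq_intros)
  have "(deriv (gCW p) has_real_derivative deriv (deriv (gCW p)) ?m) (at ?m)"
    using has_real_derivative_deriv_gCW[of ?m p] deriv2_gCW[of ?m p] P by simp
  then have "((\<lambda>u. (deriv (gCW p) (?m + u) - deriv (gCW p) ?m) / u) \<longlongrightarrow> deriv (deriv (gCW p)) ?m) (at 0)"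
    by (simp add: DERIV_def)
  then have "((\<lambda>u. (deriv (gCW p) (?m + u) / u) / 2) \<longlongrightarrow> deriv (deriv (gCW p)) ?m / 2) (at 0)"
    by (intro tendsto_intros) (simp_all add: P)
  then show "((\<lambda>u. deriv (gCW p) (?m + u) / (2 * u)) \<longlongrightarrow> - (- deriv (deriv (gCW p)) ?m / 2)) (at 0)"
    by (simp add: mult.commute)
qed

lemma gCW_expansion_minus_mstar:
  assumes p: "p \<ge> 3" "even p"
  shows "((\<lambda>u. gCW p (- mstar p + u) / u ^ 2) \<longlongrightarrow> - (- deriv (deriv (gCW p)) (mstar p) / 2)) (at 0)"
proof -
  have "((\<lambda>u. gCW p (mstar p + (-u)) / (-u) ^ 2) \<longlongrightarrow> - (- deriv (deriv (gCW p)) (mstar p) / 2)) (at 0)"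
  proof (rule filterlim_compose[OF gCW_expansion_mstar[OF p(1)]])
    show "filterlim uminus (at 0) (at (0::real))"
      by (simp add: filterlim_def filtermap_at_minus)
  qed
  moreover have "gCW p (mstar p + (-u)) = gCW p (- mstar p + u)" for u
    using gCW_minus_even[OF p(2), of "mstar p + (-u)"] by simp
  ultimately show ?thesis by simp
qed

subsection \<open>Stirling's formula up to the constant\<close>

text \<open>The quotient of n! by Stirling's approximation stripped of its constant sqrt (2 pi). At
  n = 0 the denominator is 0 and the ratio is 0, hence the recurring condition n >= 1.\<close>

definition stirlingRatio :: "nat \<Rightarrow> real" where
  "stirlingRatio n = fact n / (sqrt (real n) * (real n / exp 1) ^ n)"

lemma stirlingRatio_pos: "n \<ge> 1 \<Longrightarrow> stirlingRatio n > 0"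
  by (simp add: stirlingRatio_def)

lemma fact_eq_stirlingRatio:
  "n \<ge> 1 \<Longrightarrow> fact n = stirlingRatio n * (sqrt (real n) * (real n / exp 1) ^ n)"
  by (simp add: stirlingRatio_def)

text \<open>The increments of the logarithm are O(1/n^2), hence summable. Exponentiating the limit
  of the logarithms makes the limit of the ratios positive.\<close>

lemma stirlingRatio_convergent: "\<exists>c>0. stirlingRatio \<longlonglongrightarrow> c"
proof -
  define b where "b n = ln (stirlingRatio n)" for n
  have b: "b n = ln (fact n) - ln (real n) / 2 - real n * ln (real n) + real n" if "n \<ge> 1" for n
  proof -
    have "b n = ln (fact n) - ln (sqrt (real n) * (real n / exp 1) ^ n)"
      using that unfolding b_def stirlingRatio_def by (subst ln_div) auto
    also have "ln (sqrt (real n) * (real n / exp 1) ^ n) = ln (sqrt (real n)) + real n * ln (real n / exp 1)"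
      using that by (subst ln_mult) (auto simp: ln_realpow)
    also have "ln (real n / exp 1) = ln (real n) - 1"
      using that by (subst ln_div) auto
    finally show ?thesis using that by (simp add: ln_sqrt algebra_simps)
  qed
  have diff: "b (Suc n) - b n = 1 - (real n + 1/2) * (ln (real n + 1) - ln (real n))" if "n \<ge> 1" for n
  proof -
    have "ln (fact (Suc n) :: real) = ln (real n + 1) + ln (fact n)"
      by (simp add: ln_mult add.commute)
    then show ?thesis using that by (simp add: b algebra_simps)
  qed
  have "(\<lambda>n. b (Suc n) - b n) \<in> O(\<lambda>n. 1 / real n ^ 2)"
  proof -
    have "(\<lambda>n. 1 - (real n + 1/2) * (ln (real n + 1) - ln (real n))) \<in> O(\<lambda>n. 1 / real n ^ 2)"
      by real_asymp
    also have "?this \<longleftrightarrow> ?thesis"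
      by (rule landau_o.big.in_cong)
         (use diff in \<open>auto simp: eventually_at_top_linorder intro!: exI[of _ 1]\<close>)
    finally show ?thesis .
  qed
  moreover have "summable (\<lambda>n. norm (1 / real n ^ 2))"
    using inverse_power_summable[of 2, where 'a = real] by (simp add: field_simps)
  ultimately have "summable (\<lambda>n. b (Suc n) - b n)"
    by (rule summable_comparison_test_bigo[rotated])
  then have "(\<lambda>n. (\<Sum>k<n. b (Suc k) - b k)) \<longlonglongrightarrow> (\<Sum>k. b (Suc k) - b k)"
    by (rule summable_LIMSEQ)
  \<comment> \<open>\<open>b 0\<close> is the logarithm of a degenerate ratio; it is subtracted here
    and added back, so its value does not matter.\<close>
  then have "(\<lambda>n. b n - b 0) \<longlonglongrightarrow> (\<Sum>k. b (Suc k) - b k)"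
    by (simp add: sum_lessThan_telescope)
  then have "(\<lambda>n. (b n - b 0) + b 0) \<longlonglongrightarrow> (\<Sum>k. b (Suc k) - b k) + b 0"
    by (intro tendsto_intros)
  then have "(\<lambda>n. exp (b n)) \<longlonglongrightarrow> exp ((\<Sum>k. b (Suc k) - b k) + b 0)"
    by (intro tendsto_intros) simp
  moreover have "eventually (\<lambda>n. exp (b n) = stirlingRatio n) sequentially"
    using eventually_ge_at_top[of 1] by eventually_elim (simp add: b_def stirlingRatio_pos)
  ultimately have "stirlingRatio \<longlonglongrightarrow> exp ((\<Sum>k. b (Suc k) - b k) + b 0)"
    by (rule Lim_transform_eventually)
  then show ?thesis by (intro exI[of _ "exp ((\<Sum>k. b (Suc k) - b k) + b 0)"]) auto
qed

subsection \<open>Binomial weights\<close>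

text \<open>The mean spin when k of the N spins are +1; neighbouring values are 2/N apart.\<close>

definition grid :: "nat \<Rightarrow> nat \<Rightarrow> real" where
  "grid N k = (2 * real k - real N) / real N"

lemma grid_le_1: "k \<le> N \<Longrightarrow> \<bar>grid N k\<bar> \<le> 1"
  by (cases "N = 0") (auto simp: grid_def field_simps abs_le_iff)

text \<open>With k up-spins and j down-spins the entropy is a sum of two terms i ln(2i/N). The
  conventions \<open>0 * ln 0 = 0\<close> and \<open>0 ^ 0 = 1\<close> agree, so the endpoints are
  included.\<close>

lemma exp_Ient_grid:
  assumes "N > 0" "N = k + j"
  shows "exp (- (real N * Ient (grid N k))) = real N ^ N / (2 ^ N * (real k ^ k * real j ^ j))"
proof -
  have N: "real N = real k + real j" "real N > 0" using assms by auto
  have g: "1 + grid N k = 2 * real k / real N" "1 - grid N k = 2 * real j / real N"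
    using N by (auto simp: grid_def field_simps)
  have pw: "exp (- (real i * ln (2 * real i / real N))) = real N ^ i / (2 ^ i * real i ^ i)" for i
  proof (cases "i = 0")
    case False
    have "exp (real i * ln (2 * real i / real N)) = (2 * real i / real N) ^ i"
      using False N by (subst exp_of_nat_mult) simp
    then show ?thesis using False N by (simp add: exp_minus power_divide power_mult_distrib)
  qed simp
  have "real N * Ient (grid N k) = real k * ln (2 * real k / real N) + real j * ln (2 * real j / real N)"
    unfolding Ient_def g using N(2) by (simp add: field_simps)
  then have "exp (- (real N * Ient (grid N k)))
    = exp (- (real k * ln (2 * real k / real N))) * exp (- (real j * ln (2 * real j / real N)))"
    by (simp flip: exp_add)
  also have "\<dots> = real N ^ (k + j) / (2 ^ (k + j) * (real k ^ k * real j ^ j))"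
    unfolding pw by (simp add: power_add)
  finally show ?thesis using assms(2) by simp
qed

definition binWeight :: "nat \<Rightarrow> nat \<Rightarrow> real" where
  "binWeight N k = real (N choose k) / 2 ^ N"

lemma binWeight_nonneg: "binWeight N k \<ge> 0"
  by (simp add: binWeight_def)

text \<open>One term of the binomial expansion of (k + j)^N is at most the whole. Unlike the
  Stirling form this covers k = 0 and k = N, and it serves the region away from the peaks.\<close>

lemma binWeight_le_exp:
  assumes "k \<le> N" "N > 0"
  shows "binWeight N k \<le> exp (- (real N * Ient (grid N k)))"
proof -
  obtain j where j: "N = k + j" using assms le_Suc_ex by blast
  have "real (N choose k) * real k ^ k * real j ^ (N - k)
      \<le> (\<Sum>i\<le>N. real (N choose i) * real k ^ i * real j ^ (N - i))"
    using assms by (intro member_le_sum) auto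
  also have "\<dots> = (real k + real j) ^ N" by (rule binomial_ring[symmetric])
  finally have *: "real (N choose k) * (real k ^ k * real j ^ j) \<le> real N ^ N"
    by (simp add: j mult.assoc)
  have pos: "real k ^ k * real j ^ j > 0"
    by (cases "k = 0"; cases "j = 0") auto
  show ?thesis
    unfolding exp_Ient_grid[OF assms(2) j] binWeight_def using * pos
    by (simp add: divide_simps)
qed

text \<open>An exact identity rather than an asymptotic one: the square roots combine to N / sqrt (k
  (N - k)), which is 2 / sqrt (1 - t^2) at t = \<open>grid N k\<close>.\<close>

lemma binWeight_stirling:
  assumes "0 < k" "k < N"
  shows "sqrt (real N) * binWeight N k
    = stirlingRatio N / (stirlingRatio k * stirlingRatio (N - k))
        * (2 / sqrt (1 - (grid N k)^2)) * exp (- (real N * Ient (grid N k)))"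
proof -
  define j where "j = N - k"
  have j: "N = k + j" "j > 0" using assms by (auto simp: j_def)
  have N: "real N = real k + real j" "real N > 0" using j by auto
  have "grid N k = (real k - real j) / real N" using N(1) by (simp add: grid_def)
  moreover have "(real N)^2 - (real k - real j)^2 = 4 * (real k * real j)"
    unfolding N(1) by (simp add: power2_eq_square algebra_simps)
  moreover have "1 - ((real k - real j) / real N)^2 = ((real N)^2 - (real k - real j)^2) / (real N)^2"
    using N(2) by (subst power_divide) (simp add: diff_divide_distrib)
  ultimately have "1 - (grid N k)^2 = 4 * (real k * real j) / (real N)^2" by simp
  then have sq: "sqrt (1 - (grid N k)^2) = 2 * (sqrt (real k) * sqrt (real j)) / real N"
    using N by (simp add: real_sqrt_divide real_sqrt_mult)
  \<comment> \<open>Bookkeeping that regroups the factors of N and 2^N as the entropy identity needs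
    them.\<close>
  have rearrange: "s * (b / t) = a * ((s * s) / x) * (y / (t * z))"
    if "b = a * (s / x) * (y / z)" for a b s t x y z :: real
    using that by (simp add: ac_simps)
  have "real (N choose k) = fact N / (fact k * fact j)"
    using assms by (simp add: binomial_fact j_def)
  also have "\<dots> = (stirlingRatio N * (sqrt (real N) * (real N / exp 1) ^ N))
    / ((stirlingRatio k * (sqrt (real k) * (real k / exp 1) ^ k))
      * (stirlingRatio j * (sqrt (real j) * (real j / exp 1) ^ j)))"
    using fact_eq_stirlingRatio[of N] fact_eq_stirlingRatio[of k] fact_eq_stirlingRatio[of j] assms j(2)
    by simp
  also have "\<dots> = stirlingRatio N / (stirlingRatio k * stirlingRatio j)
     * (sqrt (real N) / (sqrt (real k) * sqrt (real j))) * (real N ^ N / (real k ^ k * real j ^ j))"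
    using j by (simp add: power_divide power_add field_simps)
  finally have choose: "real (N choose k) = stirlingRatio N / (stirlingRatio k * stirlingRatio j)
     * (sqrt (real N) / (sqrt (real k) * sqrt (real j))) * (real N ^ N / (real k ^ k * real j ^ j))" .
  have "sqrt (real N) * binWeight N k = stirlingRatio N / (stirlingRatio k * stirlingRatio j)
     * ((sqrt (real N) * sqrt (real N)) / (sqrt (real k) * sqrt (real j)))
     * (real N ^ N / (2 ^ N * (real k ^ k * real j ^ j)))"
    unfolding binWeight_def by (rule rearrange[OF choose])
  also have "sqrt (real N) * sqrt (real N) = real N" by simp
  also have "real N ^ N / (2 ^ N * (real k ^ k * real j ^ j)) = exp (- (real N * Ient (grid N k)))"
    using exp_Ient_grid[of N k j] j by simp
  also have "real N / (sqrt (real k) * sqrt (real j)) = 2 / sqrt (1 - (grid N k)^2)"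
    unfolding sq using N(2) by simp
  finally show ?thesis by (simp add: j_def)
qed

definition stirlingConst :: real where
  "stirlingConst = lim stirlingRatio"

lemma stirlingRatio_LIMSEQ: "stirlingRatio \<longlonglongrightarrow> stirlingConst"
  and stirlingConst_pos: "stirlingConst > 0"
  using stirlingRatio_convergent by (auto simp: stirlingConst_def limI)

text \<open>The positive limit controls all large n, and the finitely many others are positive.
  Bounds valid for every n >= 1 are needed for domination.\<close>

lemma stirlingRatio_bounds:
  obtains l u where "0 < l" "\<And>n. n \<ge> 1 \<Longrightarrow> l \<le> stirlingRatio n" "\<And>n. n \<ge> 1 \<Longrightarrow> stirlingRatio n \<le> u"
proof -
  have "eventually (\<lambda>n. stirlingRatio n > stirlingConst / 2) sequentially"
    using stirlingConst_pos by (intro order_tendstoD[OF stirlingRatio_LIMSEQ]) simp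
  then obtain n0 where n0: "\<And>n. n \<ge> n0 \<Longrightarrow> stirlingRatio n > stirlingConst / 2"
    by (auto simp: eventually_at_top_linorder)
  define l where "l = Min (insert (stirlingConst / 2) (stirlingRatio ` {1..n0}))"
  have l: "0 < l" using stirlingConst_pos stirlingRatio_pos by (auto simp: l_def)
  have "l \<le> stirlingRatio n" if "n \<ge> 1" for n
  proof (cases "n \<le> n0")
    case True
    then show ?thesis using that unfolding l_def by (intro Min_le) auto
  next
    case False
    have "l \<le> stirlingConst / 2" unfolding l_def by (intro Min_le) auto
    then show ?thesis using n0[of n] False by simp
  qed
  moreover obtain u where u: "\<And>n. norm (stirlingRatio n) \<le> u"
    using convergent_imp_Bseq[of stirlingRatio] stirlingRatio_LIMSEQ
    by (auto simp: convergent_def Bseq_def)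
  then have "stirlingRatio n \<le> u" for n using u[of n] by (simp add: abs_le_iff)
  ultimately show ?thesis using l that by blast
qed

subsection \<open>Gaussian domination\<close>

lemma integrable_exp_neg_square:
  assumes "a > 0"
  shows "integrable lborel (\<lambda>s::real. exp (- (a * s^2)))"
proof -
  define \<sigma> where "\<sigma> = 1 / sqrt (2 * a)"
  have \<sigma>: "\<sigma> > 0" "\<sigma>^2 = 1 / (2 * a)" using assms by (auto simp: \<sigma>_def power_divide)
  have "integrable lborel (\<lambda>s. sqrt (2 * pi * \<sigma>^2) * normal_density 0 \<sigma> s)"
    using \<sigma> by (intro integrable_mult_right integrable_normal_density)
  also have "(\<lambda>s. sqrt (2 * pi * \<sigma>^2) * normal_density 0 \<sigma> s) = (\<lambda>s. exp (- (a * s^2)))"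
    using assms by (auto simp: normal_density_def \<sigma>(2))
  finally show ?thesis .
qed

text \<open>The loss of 1 costs only a constant factor after exponentiation, so a Gaussian dominates
  the quartic peak as well as the quadratic one.\<close>

lemma square_minus_one_le_even_power:
  assumes "even r" "r \<ge> 2"
  shows "s^2 - 1 \<le> (s::real)^r"
proof (cases "\<bar>s\<bar> \<ge> 1")
  case True
  then have "\<bar>s\<bar>^2 \<le> \<bar>s\<bar>^r" using assms by (intro power_increasing) auto
  then show ?thesis using assms by (simp add: power_even_abs)
next
  case False
  then have "s^2 \<le> 1" by (simp add: abs_square_le_1)
  moreover have "0 \<le> s^r" using assms by (simp add: zero_le_even_power)
  ultimately show ?thesis by simp
qed

lemma exp_neg_even_power_le:
  assumes "even r" "r \<ge> 2" "a > 0"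
  shows "exp (- (a * (s::real)^r)) \<le> exp a * exp (- (a * s^2))"
proof -
  have "a * (s^2 - 1) \<le> a * s^r"
    using assms square_minus_one_le_even_power[of r s] by (intro mult_left_mono) auto
  then show ?thesis by (simp add: algebra_simps flip: exp_add)
qed

lemma integrable_exp_neg_even_power:
  assumes "even r" "r \<ge> 2" "a > 0"
  shows "integrable lborel (\<lambda>s::real. exp (- (a * s^r)))"
proof (rule Bochner_Integration.integrable_bound)
  show "integrable lborel (\<lambda>s::real. exp a * exp (- (a * s^2)))"
    using assms by (intro integrable_mult_right integrable_exp_neg_square)
  show "AE s in lborel. norm (exp (- (a * s^r))) \<le> norm (exp a * exp (- (a * s^2)))"
    using exp_neg_even_power_le[OF assms] by simp
qed measurable

lemma integral_exp_neg_even_power_pos: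
  assumes "even r" "r \<ge> 2" "a > 0"
  shows "0 < (\<integral>s. exp (- (a * (s::real)^r)) \<partial>lborel)"
proof -
  have "(\<integral>s. exp (- (a * (s::real)^r)) \<partial>lborel) \<noteq> 0"
  proof
    assume "(\<integral>s. exp (- (a * (s::real)^r)) \<partial>lborel) = 0"
    then have "AE s in lborel. exp (- (a * (s::real)^r)) = 0"
      using integral_nonneg_eq_0_iff_AE[OF integrable_exp_neg_even_power[OF assms]] by simp
    then have "AE s in (lborel::real measure). False" by simp
    then show False by (simp add: eventually_False ae_filter_eq_bot_iff)
  qed
  moreover have "0 \<le> (\<integral>s. exp (- (a * (s::real)^r)) \<partial>lborel)" by simp
  ultimately show ?thesis by linarith
qed

subsection \<open>Sums as integrals of step functions\<close>

definition stepFun :: "nat \<Rightarrow> (nat \<Rightarrow> real) \<Rightarrow> real \<Rightarrow> real" where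
  "stepFun N a y = (\<Sum>k\<le>N. a k * indicator {real k..<real k + 1} y)"

lemma stepFun_measurable [measurable]: "stepFun N a \<in> borel_measurable borel"
  unfolding stepFun_def [abs_def] by measurable

lemma stepFun_eq:
  assumes "0 \<le> y" "y < real N + 1"
  shows "stepFun N a y = a (nat \<lfloor>y\<rfloor>)"
proof -
  have "stepFun N a y = (\<Sum>k\<le>N. if k = nat \<lfloor>y\<rfloor> then a k else 0)"
    unfolding stepFun_def using assms
    by (intro sum.cong refl) (auto simp: indicator_def, linarith+)
  also have "\<dots> = a (nat \<lfloor>y\<rfloor>)" using assms by (subst sum.delta) (auto, linarith)
  finally show ?thesis .
qed

lemma stepFun_eq_0:
  assumes "\<not> (0 \<le> y \<and> y < real N + 1)"
  shows "stepFun N a y = 0"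
  unfolding stepFun_def using assms
  by (intro sum.neutral ballI) (auto simp: indicator_def)

text \<open>Every step has length 1, so the integral is the sum. The affine change of variable is
  free to zoom in on a peak with t as center and L as scale.\<close>

lemma sum_eq_integral_stepFun:
  assumes "L > 0"
  shows "(\<Sum>k\<le>N. a k) = L * (\<integral>s. stepFun N a (t + L * s) \<partial>lborel)"
proof -
  have "(\<integral>y. stepFun N a y \<partial>lborel) = (\<Sum>k\<le>N. (\<integral>y. a k * indicator {real k..<real k + 1} y \<partial>lborel))"
    unfolding stepFun_def
    by (intro Bochner_Integration.integral_sum integrable_mult_right integrable_real_indicator) auto
  also have "\<dots> = (\<Sum>k\<le>N. a k)" by simp
  finally show ?thesis
    using lborel_integral_real_affine[of L "stepFun N a" t] assms by simp
qed

subsection \<open>Laplace asymptotics of one peak\<close>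

text \<open>A is the exact local coefficient, which enters the limit; a is a cruder one, valid on
  the whole window and used for domination. F may depend on N because the estimate is rescaled with
  N.\<close>

locale peak =
  fixes g :: "real \<Rightarrow> real" and c \<delta> A a :: real and r :: nat
    and F :: "nat \<Rightarrow> real \<Rightarrow> real" and G :: "real \<Rightarrow> real" and B :: real
  assumes even_r: "even r" and r_ge: "r \<ge> 2" and a_pos: "a > 0" and d_pos: "\<delta> > 0"
    and inside: "\<bar>c\<bar> + \<delta> < 1"
    and upper: "\<And>u. \<bar>u\<bar> \<le> \<delta> \<Longrightarrow> g (c + u) \<le> - (a * u ^ r)"
    and expansion: "((\<lambda>u. g (c + u) / u ^ r) \<longlongrightarrow> - A) (at 0)"
    and g_c: "g c = 0"
    and F_bound: "\<And>N t. \<bar>F N t\<bar> \<le> B"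
    and G_meas [measurable]: "G \<in> borel_measurable borel"
    and F_lim: "AE s in lborel. \<forall>x. x \<longlonglongrightarrow> s \<longrightarrow>
        (\<lambda>N. F N (c + x N * real N powr (- 1 / real r))) \<longlonglongrightarrow> G s"
begin

definition nu :: "nat \<Rightarrow> real" where "nu N = real N powr (- 1 / real r)"

text \<open>The entropy is added back to g because \<open>binWeight\<close> already carries the
  factor exp(-N Ient); together they form the Gibbs weight, restricted to the window.\<close>

definition summand :: "nat \<Rightarrow> nat \<Rightarrow> real" where
  "summand N k = (if \<bar>grid N k - c\<bar> \<le> \<delta>
     then binWeight N k * exp (real N * (g (grid N k) + Ient (grid N k))) * F N (grid N k) else 0)"

text \<open>The real position on the index axis whose mean spin is c + s
  \<open>nu N\<close>.\<close>

definition loc :: "nat \<Rightarrow> real \<Rightarrow> real" where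
  "loc N s = real N * (1 + c) / 2 + (real N * nu N / 2) * s"

text \<open>The rescaled coordinate of the lattice point actually used at s, after rounding
  \<open>loc N s\<close> down.\<close>

definition snap :: "nat \<Rightarrow> real \<Rightarrow> real" where
  "snap N s = (grid N (nat \<lfloor>loc N s\<rfloor>) - c) / nu N"

lemma nu_pos: "N > 0 \<Longrightarrow> nu N > 0"
  by (simp add: nu_def)

text \<open>The scale is chosen so that N times the leading term -A u^r at u = s \<open>nu N\<close>
  no longer depends on N.\<close>

lemma nu_power: "N > 0 \<Longrightarrow> nu N ^ r * real N = 1"
proof -
  assume "N > 0"
  then have "nu N ^ r = real N powr (- 1 / real r * real r)"
    by (simp add: nu_def powr_powr flip: powr_realpow)
  then show ?thesis using \<open>N > 0\<close> r_ge by (simp add: powr_minus)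
qed

lemma nu_LIMSEQ: "nu \<longlonglongrightarrow> 0"
  unfolding nu_def [abs_def] using r_ge
  by (intro tendsto_neg_powr filterlim_real_sequentially) (simp add: field_simps)

lemma N_nu_ge: "N > 0 \<Longrightarrow> real N * nu N \<ge> 1"
proof -
  assume N: "N > 0"
  have "real N * nu N = real N powr (1 + (- 1 / real r))"
    unfolding nu_def powr_add using N by simp
  also have "\<dots> \<ge> 1" using N r_ge by (intro ge_one_powr_ge_zero) (auto simp: field_simps)
  finally show ?thesis .
qed

lemma inverse_N_nu_LIMSEQ: "(\<lambda>N. 2 / (real N * nu N)) \<longlonglongrightarrow> 0"
proof -
  have e: "- (1 - 1 / real r) < 0" using r_ge by (simp add: field_simps)
  have "(\<lambda>N. 2 * real N powr (- (1 - 1 / real r))) \<longlonglongrightarrow> 2 * 0"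
    by (intro tendsto_intros tendsto_neg_powr filterlim_real_sequentially e)
  moreover have "eventually (\<lambda>N. 2 * real N powr (- (1 - 1 / real r)) = 2 / (real N * nu N)) sequentially"
    using eventually_gt_at_top[of 0]
  proof eventually_elim
    case (elim N)
    have "real N * nu N = real N powr (1 - 1 / real r)"
      unfolding nu_def using elim by (simp add: powr_diff powr_minus field_simps)
    then show ?case using elim by (simp only: powr_minus) (simp add: field_simps)
  qed
  ultimately show ?thesis using Lim_transform_eventually by fastforce
qed

lemma grid_snap: "N > 0 \<Longrightarrow> grid N (nat \<lfloor>loc N s\<rfloor>) = c + snap N s * nu N"
  using nu_pos[of N] by (simp add: snap_def)

text \<open>Rounding down loses at most one lattice step, which is 2 / (N \<open>nu N\<close>) in
  the rescaled coordinate. The sign condition keeps \<open>nat\<close> from truncating.\<close>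

lemma snap_bounds:
  assumes "N > 0" "loc N s \<ge> 0"
  shows "snap N s \<le> s" "s - 2 / (real N * nu N) \<le> snap N s"
proof -
  define k where "k = nat \<lfloor>loc N s\<rfloor>"
  have k: "real k \<le> loc N s" "loc N s \<le> real k + 1"
    using assms(2) unfolding k_def by linarith+
  have "snap N s = (2 * real k / real N - 1 - c) / nu N"
    using assms by (simp add: snap_def k_def grid_def diff_divide_distrib)
  then have *: "s - snap N s = 2 / (real N * nu N) * (loc N s - real k)"
    using assms nu_pos[of N] by (simp add: loc_def field_simps)
  have pos: "2 / (real N * nu N) > 0" using assms nu_pos[of N] by simp
  have "2 / (real N * nu N) * (loc N s - real k) \<ge> 0"
    using pos k by (intro mult_nonneg_nonneg) auto
  then show "snap N s \<le> s" using * by simp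
  have "2 / (real N * nu N) * (loc N s - real k) \<le> 2 / (real N * nu N) * 1"
    using pos k by (intro mult_left_mono) auto
  then show "s - 2 / (real N * nu N) \<le> snap N s" using * by simp
qed

text \<open>The window lies strictly inside (-1, 1), so k and N - k are positive and the Stirling
  form applies. Its entropy factor cancels the one added in \<open>summand\<close>.\<close>

lemma summand_eq:
  assumes "N > 0" "k \<le> N" "\<bar>grid N k - c\<bar> \<le> \<delta>"
  shows "0 < k" "k < N"
    "sqrt (real N) * summand N k = stirlingRatio N / (stirlingRatio k * stirlingRatio (N - k))
        * (2 / sqrt (1 - (grid N k)^2)) * exp (real N * g (grid N k)) * F N (grid N k)"
proof -
  have "\<bar>grid N k\<bar> < 1" using assms(3) inside by linarith
  then have "-1 < grid N k" "grid N k < 1" by auto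
  then show k: "0 < k" "k < N" using assms by (auto simp: grid_def field_simps)
  show "sqrt (real N) * summand N k = stirlingRatio N / (stirlingRatio k * stirlingRatio (N - k))
        * (2 / sqrt (1 - (grid N k)^2)) * exp (real N * g (grid N k)) * F N (grid N k)"
  proof -
    have "sqrt (real N) * summand N k = (sqrt (real N) * binWeight N k) *
        (exp (real N * (g (grid N k) + Ient (grid N k))) * F N (grid N k))"
      using assms by (simp add: summand_def)
    also have "\<dots> = stirlingRatio N / (stirlingRatio k * stirlingRatio (N - k))
        * (2 / sqrt (1 - (grid N k)^2)) * (exp (- (real N * Ient (grid N k))) *
        exp (real N * (g (grid N k) + Ient (grid N k)))) * F N (grid N k)"
      unfolding binWeight_stirling[OF k] by simp
    also have "exp (- (real N * Ient (grid N k))) * exp (real N * (g (grid N k) + Ient (grid N k)))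
        = exp (real N * g (grid N k))"
      by (simp add: algebra_simps flip: exp_add)
    finally show ?thesis .
  qed
qed

lemma B_nonneg: "0 \<le> B"
  using F_bound[of 0 0] by linarith

lemma dominated:
  obtains K where "K \<ge> 0" "\<And>N s. N > 0 \<Longrightarrow>
    \<bar>stepFun N (\<lambda>k. sqrt (real N) * summand N k) (loc N s)\<bar> \<le> K * exp (- (a / 2 * s^2))"
proof -
  obtain l u where lu: "0 < l" "\<And>n. n \<ge> 1 \<Longrightarrow> l \<le> stirlingRatio n" "\<And>n. n \<ge> 1 \<Longrightarrow> stirlingRatio n \<le> u"
    by (rule stirlingRatio_bounds) blast
  define S where "S = 2 / sqrt (1 - (\<bar>c\<bar> + \<delta>)^2)"
  have sq: "0 < 1 - (\<bar>c\<bar> + \<delta>)^2"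
    using inside d_pos by (simp add: power_less_one_iff)
  have S: "S > 0" using sq by (simp add: S_def)
  have u: "0 < u" using lu(1) lu(2)[of 1] lu(3)[of 1] by simp
  \<comment> \<open>The factors bound the Stirling ratios, the root, the exponential and F. In
    \<open>exp (5 * a)\<close> one a pays for replacing x^r by x^2 - 1, and 4a for the displacement
    |s - x| <= 2 through s^2/2 - 4 <= x^2, which also halves the Gaussian rate.\<close>
  define K where "K = u / (l * l) * S * exp (5 * a) * B"
  have K: "K \<ge> 0" using lu S u B_nonneg by (simp add: K_def)
  show thesis
  proof (rule that[OF K])
    fix N :: nat and s :: real assume N: "N > 0"
    show "\<bar>stepFun N (\<lambda>k. sqrt (real N) * summand N k) (loc N s)\<bar> \<le> K * exp (- (a / 2 * s^2))"
    proof (cases "0 \<le> loc N s \<and> loc N s < real N + 1")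
      case False
      then show ?thesis using K by (simp add: stepFun_eq_0)
    next
      case True
      define k where "k = nat \<lfloor>loc N s\<rfloor>"
      have kN: "k \<le> N" using True by (simp add: k_def) linarith
      have step: "stepFun N (\<lambda>k. sqrt (real N) * summand N k) (loc N s) = sqrt (real N) * summand N k"
        using True by (subst stepFun_eq) (auto simp: k_def)
      define x where "x = snap N s"
      have gx: "grid N k = c + x * nu N" using grid_snap[OF N] by (simp add: k_def x_def)
      show ?thesis
      proof (cases "\<bar>grid N k - c\<bar> \<le> \<delta>")
        case False
        then show ?thesis using K unfolding step by (simp add: summand_def)
      next
        case near: True
        note t = summand_eq[OF N kN near]
        have "2 / (real N * nu N) \<le> 2" using N_nu_ge[OF N] by (simp add: field_simps)
        then have "\<bar>s - x\<bar> \<le> 2" using snap_bounds[of N s] N True by (simp add: x_def)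
        then have "(s - x)^2 \<le> 2^2" by (rule abs_le_square_iff[THEN iffD1, OF order_trans]) simp
        moreover have "s^2 \<le> 2 * x^2 + 2 * (s - x)^2"
          using zero_le_power2[of "s - 2 * x"] by (simp add: power2_eq_square algebra_simps)
        ultimately have sx: "s^2 / 2 - 4 \<le> x^2" by simp
        have "real N * g (grid N k) \<le> real N * (- (a * (x * nu N) ^ r))"
          unfolding gx using near by (intro mult_left_mono upper) (auto simp: gx)
        also have "\<dots> = - (a * x ^ r) * (nu N ^ r * real N)" by (simp add: power_mult_distrib)
        finally have "real N * g (grid N k) \<le> - (a * x ^ r)" using nu_power[OF N] by simp
        then have "exp (real N * g (grid N k)) \<le> exp (- (a * x ^ r))" by simp
        also have "\<dots> \<le> exp a * exp (- (a * x^2))" by (rule exp_neg_even_power_le[OF even_r r_ge a_pos])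
        also have "\<dots> \<le> exp a * exp (4 * a - a / 2 * s^2)"
          using mult_left_mono[OF sx, of a] a_pos by (simp add: algebra_simps)
        also have "\<dots> = exp (5 * a) * exp (- (a / 2 * s^2))" by (simp flip: exp_add)
        finally have E: "exp (real N * g (grid N k)) \<le> exp (5 * a) * exp (- (a / 2 * s^2))" .
        have "\<bar>grid N k\<bar> \<le> \<bar>c\<bar> + \<delta>" using near by linarith
        then have "(grid N k)^2 \<le> (\<bar>c\<bar> + \<delta>)^2" using d_pos by (subst abs_le_square_iff[symmetric]) auto
        then have S': "2 / sqrt (1 - (grid N k)^2) \<le> S" "0 \<le> 2 / sqrt (1 - (grid N k)^2)"
          unfolding S_def using sq by (auto intro!: divide_left_mono mult_pos_pos)
        have R: "stirlingRatio N / (stirlingRatio k * stirlingRatio (N - k)) \<le> u / (l * l)"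
          "0 \<le> stirlingRatio N / (stirlingRatio k * stirlingRatio (N - k))"
        proof -
          have p: "l \<le> stirlingRatio k" "l \<le> stirlingRatio (N - k)" "stirlingRatio N \<le> u" "l \<le> stirlingRatio N"
            using lu t by auto
          show "stirlingRatio N / (stirlingRatio k * stirlingRatio (N - k)) \<le> u / (l * l)"
            using p lu u by (intro frac_le mult_mono) auto
          show "0 \<le> stirlingRatio N / (stirlingRatio k * stirlingRatio (N - k))"
            using p lu by auto
        qed
        have "\<bar>sqrt (real N) * summand N k\<bar> = stirlingRatio N / (stirlingRatio k * stirlingRatio (N - k))
          * (2 / sqrt (1 - (grid N k)^2)) * exp (real N * g (grid N k)) * \<bar>F N (grid N k)\<bar>"
          unfolding t(3) abs_mult using R(2) S'(2) by (simp only: abs_of_nonneg abs_exp_cancel)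
        also have "\<dots> \<le> u / (l * l) * S * (exp (5 * a) * exp (- (a / 2 * s^2))) * B"
          using R S' E F_bound u lu S by (intro mult_mono mult_nonneg_nonneg) auto
        finally show ?thesis unfolding step K_def by (simp add: ac_simps)
      qed
    qed
  qed
qed

text \<open>For fixed s the selected lattice point tends to c, so both k and N - k tend to infinity
  and the three Stirling ratios leave 1 / \<open>stirlingConst\<close>.\<close>

lemma pointwise:
  assumes s: "\<And>x. x \<longlonglongrightarrow> s \<Longrightarrow> (\<lambda>N. F N (c + x N * nu N)) \<longlonglongrightarrow> G s"
  shows "(\<lambda>N. stepFun N (\<lambda>k. sqrt (real N) * summand N k) (loc N s)) \<longlonglongrightarrow>
    1 / stirlingConst * (2 / sqrt (1 - c^2)) * exp (- (A * s ^ r)) * G s"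
proof -
  define k where "k N = nat \<lfloor>loc N s\<rfloor>" for N
  define M where "M N = grid N (k N)" for N
  have locN: "loc N s = real N * ((1 + (c + nu N * s)) / 2)" for N
    by (simp add: loc_def algebra_simps add_divide_distrib)
  have cs: "(\<lambda>N. c + nu N * s) \<longlonglongrightarrow> c"
    by (auto intro!: tendsto_eq_intros nu_LIMSEQ)
  have c1: "-1 < c" "c < 1" using inside d_pos by auto
  have ev: "eventually (\<lambda>N. N > 0 \<and> 0 \<le> loc N s \<and> loc N s < real N + 1) sequentially"
    using order_tendstoD(1)[OF cs c1(1)] order_tendstoD(2)[OF cs c1(2)] eventually_gt_at_top[of 0]
  proof eventually_elim
    case (elim N)
    have "real N * ((1 + (c + nu N * s)) / 2) \<le> real N * 1"
      using elim by (intro mult_left_mono) auto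
    moreover have "0 \<le> real N * ((1 + (c + nu N * s)) / 2)"
      using elim by (intro mult_nonneg_nonneg) auto
    ultimately show ?case using elim unfolding locN by linarith
  qed
  have snap: "(\<lambda>N. snap N s) \<longlonglongrightarrow> s"
  proof (rule tendsto_sandwich)
    show "(\<lambda>N. s - 2 / (real N * nu N)) \<longlonglongrightarrow> s"
      using tendsto_diff[OF tendsto_const inverse_N_nu_LIMSEQ, of s] by simp
    show "eventually (\<lambda>N. s - 2 / (real N * nu N) \<le> snap N s) sequentially"
      using ev by eventually_elim (use snap_bounds in auto)
    show "eventually (\<lambda>N. snap N s \<le> s) sequentially"
      using ev by eventually_elim (use snap_bounds in auto)
  qed auto
  have u: "(\<lambda>N. snap N s * nu N) \<longlonglongrightarrow> 0"
    using tendsto_mult[OF snap nu_LIMSEQ] by simp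
  have "(\<lambda>N. c + snap N s * nu N) \<longlonglongrightarrow> c + 0"
    by (intro tendsto_intros u)
  moreover have evM: "eventually (\<lambda>N. c + snap N s * nu N = M N) sequentially"
    using ev by eventually_elim (simp add: M_def k_def grid_snap)
  ultimately have Mlim: "M \<longlonglongrightarrow> c"
    using Lim_transform_eventually by fastforce
  have Flim: "(\<lambda>N. F N (M N)) \<longlonglongrightarrow> G s"
  proof (rule Lim_transform_eventually[OF s[OF snap]])
    show "eventually (\<lambda>N. F N (c + snap N s * nu N) = F N (M N)) sequentially"
      using evM by eventually_elim simp
  qed
  have near: "eventually (\<lambda>N. \<bar>M N - c\<bar> \<le> \<delta>) sequentially"
    using tendstoD[OF Mlim d_pos] by eventually_elim (simp add: dist_real_def)
  have half: "(\<lambda>N. (1 + M N) / 2) \<longlonglongrightarrow> (1 + c) / 2" "(\<lambda>N. (1 - M N) / 2) \<longlonglongrightarrow> (1 - c) / 2"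
    by (intro tendsto_intros Mlim; simp)+
  have kM: "real (k N) = (1 + M N) / 2 * real N" if "N > 0" for N
    using that by (simp add: M_def grid_def field_simps)
  have ev0: "eventually (\<lambda>N. N > (0::nat)) sequentially" by (rule eventually_gt_at_top)
  have lim1: "filterlim (\<lambda>N. (1 + M N) / 2 * real N) at_top sequentially"
    using c1 by (intro filterlim_tendsto_pos_mult_at_top[OF half(1) _ filterlim_real_sequentially]) simp
  have eq1: "eventually (\<lambda>N. (1 + M N) / 2 * real N = real (k N)) sequentially"
    using ev0 by eventually_elim (rule kM[symmetric])
  have "filterlim (\<lambda>N. real (k N)) at_top sequentially"
    using lim1 by (rule filterlim_cong[OF refl refl eq1, THEN iffD1])
  then have klim: "filterlim k at_top sequentially"
    unfolding filterlim_sequentially_iff_filterlim_real .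
  have evk: "eventually (\<lambda>N. k N \<le> N) sequentially"
    using ev by eventually_elim (simp add: k_def, linarith)
  have lim2: "filterlim (\<lambda>N. (1 - M N) / 2 * real N) at_top sequentially"
    using c1 by (intro filterlim_tendsto_pos_mult_at_top[OF half(2) _ filterlim_real_sequentially]) simp
  have eq2: "eventually (\<lambda>N. (1 - M N) / 2 * real N = real (N - k N)) sequentially"
    using ev0 evk by eventually_elim (subst of_nat_diff, simp, subst kM, simp, simp add: field_simps)
  have "filterlim (\<lambda>N. real (N - k N)) at_top sequentially"
    using lim2 by (rule filterlim_cong[OF refl refl eq2, THEN iffD1])
  then have jlim: "filterlim (\<lambda>N. N - k N) at_top sequentially"
    unfolding filterlim_sequentially_iff_filterlim_real .
  \<comment> \<open>The quotient is extended continuously to 0, because the lattice may hit the peak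
    exactly and then u = 0.\<close>
  define \<gamma> where "\<gamma> u = (if u = 0 then - A else g (c + u) / u ^ r)" for u
  have "((\<lambda>u. g (c + u) / u ^ r) \<longlongrightarrow> - A) (at 0) \<longleftrightarrow> (\<gamma> \<longlongrightarrow> - A) (at 0)"
    by (rule filterlim_cong) (auto simp: \<gamma>_def eventually_at_filter)
  then have "isCont \<gamma> 0" using expansion by (simp add: isCont_def \<gamma>_def)
  then have \<gamma>lim: "(\<lambda>N. \<gamma> (snap N s * nu N)) \<longlonglongrightarrow> - A"
    using isCont_tendsto_compose[OF _ u, of \<gamma>] by (simp add: \<gamma>_def)
  have g\<gamma>: "g (c + u) = \<gamma> u * u ^ r" for u
    using g_c r_ge by (auto simp: \<gamma>_def)
  have "(\<lambda>N. \<gamma> (snap N s * nu N) * snap N s ^ r) \<longlonglongrightarrow> - A * s ^ r"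
    by (intro tendsto_intros \<gamma>lim snap)
  moreover have "eventually (\<lambda>N. \<gamma> (snap N s * nu N) * snap N s ^ r = real N * g (M N)) sequentially"
    using ev0 evM
  proof eventually_elim
    case (elim N)
    have "real N * g (M N) = \<gamma> (snap N s * nu N) * snap N s ^ r * (nu N ^ r * real N)"
      unfolding elim(2)[symmetric] g\<gamma> by (simp add: power_mult_distrib)
    then show ?case using nu_power elim by simp
  qed
  ultimately have glim: "(\<lambda>N. real N * g (M N)) \<longlonglongrightarrow> - A * s ^ r"
    using Lim_transform_eventually by fastforce
  have "c^2 < 1" using c1 by (simp add: abs_square_less_1)
  then have "(\<lambda>N. stirlingRatio N / (stirlingRatio (k N) * stirlingRatio (N - k N))
        * (2 / sqrt (1 - (M N)^2)) * exp (real N * g (M N)) * F N (M N)) \<longlonglongrightarrow>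
      stirlingConst / (stirlingConst * stirlingConst) * (2 / sqrt (1 - c^2)) * exp (- A * s ^ r) * G s"
    using stirlingConst_pos
    by (intro tendsto_intros stirlingRatio_LIMSEQ filterlim_compose[OF stirlingRatio_LIMSEQ klim]
        filterlim_compose[OF stirlingRatio_LIMSEQ jlim] Mlim glim Flim) auto
  moreover have "eventually (\<lambda>N. stirlingRatio N / (stirlingRatio (k N) * stirlingRatio (N - k N))
        * (2 / sqrt (1 - (M N)^2)) * exp (real N * g (M N)) * F N (M N)
      = stepFun N (\<lambda>k. sqrt (real N) * summand N k) (loc N s)) sequentially"
    using ev evk near
  proof eventually_elim
    case (elim N)
    then show ?case
      using summand_eq(3)[of N "k N"] by (subst stepFun_eq) (auto simp: M_def k_def)
  qed
  ultimately show ?thesis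
    using Lim_transform_eventually stirlingConst_pos by fastforce
qed

lemma peak_sum:
  "(\<lambda>N. (\<Sum>k\<le>N. summand N k) / (sqrt (real N) * nu N)) \<longlonglongrightarrow>
     1 / stirlingConst * (1 / sqrt (1 - c^2) * (\<integral>s. exp (- (A * s ^ r)) * G s \<partial>lborel))"
proof -
  let ?\<Phi> = "\<lambda>N s. stepFun N (\<lambda>k. sqrt (real N) * summand N k) (loc N s)"
  let ?\<Psi> = "\<lambda>s. 1 / stirlingConst * (2 / sqrt (1 - c^2)) * exp (- (A * s ^ r)) * G s"
  obtain K where K: "K \<ge> 0" "\<And>N s. N > 0 \<Longrightarrow> \<bar>?\<Phi> N s\<bar> \<le> K * exp (- (a / 2 * s^2))"
    by (rule dominated) blast
  \<comment> \<open>The dominating bound holds for N > 0, so the sequence is shifted by one.\<close>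
  have "(\<lambda>N. integral\<^sup>L lborel (?\<Phi> (Suc N))) \<longlonglongrightarrow> integral\<^sup>L lborel ?\<Psi>"
  proof (rule integral_dominated_convergence)
    show "?\<Psi> \<in> borel_measurable lborel" by measurable
    show "?\<Phi> (Suc N) \<in> borel_measurable lborel" for N
      unfolding loc_def by measurable
    show "integrable lborel (\<lambda>s. K * exp (- (a / 2 * s^2)))"
      using a_pos by (intro integrable_mult_right integrable_exp_neg_square) simp
    show "AE s in lborel. (\<lambda>N. ?\<Phi> (Suc N) s) \<longlonglongrightarrow> ?\<Psi> s"
      using F_lim
    proof eventually_elim
      case (elim s)
      then show ?case by (intro LIMSEQ_Suc pointwise) (simp add: nu_def)
    qed
    show "AE s in lborel. norm (?\<Phi> (Suc N) s) \<le> K * exp (- (a / 2 * s^2))" for N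
      using K(2)[of "Suc N"] by simp
  qed
  \<comment> \<open>The 1/2 comes from the lattice spacing 2/N and cancels the 2 in
    \<open>2 / sqrt (1 - c^2)\<close>.\<close>
  then have "(\<lambda>N. 1 / 2 * integral\<^sup>L lborel (?\<Phi> N)) \<longlonglongrightarrow> 1 / 2 * integral\<^sup>L lborel ?\<Psi>"
    by (intro tendsto_intros) (rule filterlim_sequentially_Suc[of "\<lambda>N. integral\<^sup>L lborel (?\<Phi> N)", THEN iffD1])
  moreover have "1 / 2 * integral\<^sup>L lborel ?\<Psi> =
      1 / stirlingConst * (1 / sqrt (1 - c^2) * (\<integral>s. exp (- (A * s ^ r)) * G s \<partial>lborel))"
    by (simp add: mult.assoc)
  moreover have "eventually (\<lambda>N. 1 / 2 * integral\<^sup>L lborel (?\<Phi> N)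
      = (\<Sum>k\<le>N. summand N k) / (sqrt (real N) * nu N)) sequentially"
    using eventually_gt_at_top[of 0]
  proof eventually_elim
    case (elim N)
    have L: "real N * nu N / 2 > 0" using elim nu_pos[of N] by simp
    have "sqrt (real N) * (\<Sum>k\<le>N. summand N k) = (real N * nu N / 2) * integral\<^sup>L lborel (?\<Phi> N)"
      unfolding sum_distrib_left loc_def by (rule sum_eq_integral_stepFun[OF L])
    also have "\<dots> = sqrt (real N) * (sqrt (real N) * nu N * (1 / 2 * integral\<^sup>L lborel (?\<Phi> N)))"
      by simp
    finally have "(\<Sum>k\<le>N. summand N k) = sqrt (real N) * nu N * (1 / 2 * integral\<^sup>L lborel (?\<Phi> N))"
      using elim by simp
    then show ?case using elim nu_pos[of N] by simp
  qed
  ultimately show ?thesis using Lim_transform_eventually by fastforce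
qed

end

subsection \<open>Finitely many peaks\<close>

definition latticeSum :: "(real \<Rightarrow> real) \<Rightarrow> (nat \<Rightarrow> real \<Rightarrow> real) \<Rightarrow> nat \<Rightarrow> real" where
  "latticeSum g F N = (\<Sum>k\<le>N. binWeight N k * exp (real N * (g (grid N k) + Ient (grid N k))) * F N (grid N k))"

text \<open>A single exponent r serves all peaks: peaks of different order would contribute at
  different powers of N and could not share a limit as a mixture.\<close>

locale peaks =
  fixes g :: "real \<Rightarrow> real" and C :: "real set" and A :: "real \<Rightarrow> real" and r :: nat
  assumes even_r: "even r" and r_ge: "r \<ge> 2"
    and finite_C: "finite C" and C_nonempty: "C \<noteq> {}" and C_inside: "\<And>c. c \<in> C \<Longrightarrow> \<bar>c\<bar> < 1"
    and cont: "continuous_on {-1..1} g"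
    and A_pos: "\<And>c. c \<in> C \<Longrightarrow> A c > 0"
    and g_zero: "\<And>c. c \<in> C \<Longrightarrow> g c = 0"
    and g_neg: "\<And>t. t \<in> {-1..1} \<Longrightarrow> t \<notin> C \<Longrightarrow> g t < 0"
    and expansion: "\<And>c. c \<in> C \<Longrightarrow> ((\<lambda>u. g (c + u) / u ^ r) \<longlongrightarrow> - A c) (at 0)"
begin

text \<open>Halving the coefficient turns the limit at each peak into an inequality on a whole
  window, and the factor 2 makes the windows disjoint. Finiteness of C gives a common
  radius.\<close>

lemma separated_radius:
  obtains \<delta> where "\<delta> > 0"
    "\<And>c u. c \<in> C \<Longrightarrow> \<bar>u\<bar> \<le> \<delta> \<Longrightarrow> g (c + u) \<le> - (A c / 2 * u ^ r)"
    "\<And>c. c \<in> C \<Longrightarrow> \<bar>c\<bar> + \<delta> < 1"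
    "\<And>c c'. c \<in> C \<Longrightarrow> c' \<in> C \<Longrightarrow> c \<noteq> c' \<Longrightarrow> 2 * \<delta> < \<bar>c - c'\<bar>"
proof -
  define P where "P c \<delta> \<longleftrightarrow> (\<forall>u. \<bar>u\<bar> \<le> \<delta> \<longrightarrow> g (c + u) \<le> - (A c / 2 * u ^ r)) \<and> \<bar>c\<bar> + \<delta> < 1 \<and>
     (\<forall>c'\<in>C. c \<noteq> c' \<longrightarrow> 2 * \<delta> < \<bar>c - c'\<bar>)" for c \<delta>
  have "eventually (P c) (at_right 0)" if c: "c \<in> C" for c
  proof -
    have "eventually (\<lambda>u. g (c + u) / u ^ r < - (A c / 2)) (at 0)"
      using A_pos[OF c] by (intro order_tendstoD[OF expansion[OF c]]) simp
    then obtain d where d: "d > 0" "\<And>u. u \<noteq> 0 \<Longrightarrow> \<bar>u\<bar> < d \<Longrightarrow> g (c + u) / u ^ r < - (A c / 2)"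
      by (auto simp: eventually_at dist_real_def)
    have small: "eventually (\<lambda>\<delta>. \<delta> \<in> {0<..<e}) (at_right 0)" if "e > 0" for e :: real
      by (rule eventually_at_right_real[OF that])
    have upper: "g (c + u) \<le> - (A c / 2 * u ^ r)" if "\<bar>u\<bar> < d" for u
    proof (cases "u = 0")
      case True
      then show ?thesis using g_zero[OF c] r_ge by (simp add: power_0_left)
    next
      case False
      then have "u ^ r > 0" using even_r by (simp add: zero_less_power_eq)
      then show ?thesis using d(2)[OF False that] by (simp add: field_simps)
    qed
    have "eventually (\<lambda>\<delta>. \<forall>c'\<in>C. c \<noteq> c' \<longrightarrow> 2 * \<delta> < \<bar>c - c'\<bar>) (at_right 0)"
    proof (intro eventually_ball_finite finite_C ballI)
      fix c' assume "c' \<in> C"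
      show "eventually (\<lambda>\<delta>. c \<noteq> c' \<longrightarrow> 2 * \<delta> < \<bar>c - c'\<bar>) (at_right 0)"
      proof (cases "c = c'")
        case False
        then show ?thesis using small[of "\<bar>c - c'\<bar> / 2"] by (auto elim!: eventually_mono)
      qed simp
    qed
    moreover have "eventually (\<lambda>\<delta>. \<delta> \<in> {0<..<1 - \<bar>c\<bar>}) (at_right 0)"
      using C_inside[OF c] by (intro small) simp
    ultimately show ?thesis using small[OF d(1)]
      unfolding P_def by eventually_elim (intro conjI allI impI upper; force)
  qed
  then have "eventually (\<lambda>\<delta>. \<forall>c\<in>C. P c \<delta>) (at_right 0)"
    by (intro eventually_ball_finite finite_C ballI)
  moreover have "eventually (\<lambda>\<delta>::real. \<delta> > 0) (at_right 0)"
    by (rule eventually_at_right_less)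
  ultimately have "eventually (\<lambda>\<delta>. (\<forall>c\<in>C. P c \<delta>) \<and> \<delta> > 0) (at_right 0)"
    by eventually_elim auto
  then obtain \<delta> where "\<forall>c\<in>C. P c \<delta>" "\<delta> > 0"
    by (metis (mono_tags, lifting) eventually_happens' trivial_limit_at_right_real)
  then show thesis by (intro that[of \<delta>]) (auto simp: P_def)
qed

text \<open>Removing open balls leaves a compact set, on which the negative continuous function g
  attains its maximum.\<close>

lemma away_bound:
  assumes "\<delta> > 0"
  obtains \<eta> where "\<eta> > 0" "\<And>t. t \<in> {-1..1} \<Longrightarrow> (\<And>c. c \<in> C \<Longrightarrow> \<delta> \<le> \<bar>t - c\<bar>) \<Longrightarrow> g t \<le> - \<eta>"
proof -
  define K where "K = {-1..1} - (\<Union>c\<in>C. ball c \<delta>)"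
  have K: "t \<in> K \<longleftrightarrow> t \<in> {-1..1} \<and> (\<forall>c\<in>C. \<delta> \<le> \<bar>t - c\<bar>)" for t
    by (auto simp: K_def dist_real_def abs_minus_commute not_less)
  have comp: "compact K" unfolding K_def by (intro compact_diff) auto
  show thesis
  proof (cases "K = {}")
    case True
    then show thesis using K by (intro that[of 1]) auto
  next
    case False
    have "continuous_on K g" by (rule continuous_on_subset[OF cont]) (auto simp: K_def)
    then obtain m where m: "m \<in> K" "\<And>t. t \<in> K \<Longrightarrow> g t \<le> g m"
      using continuous_attains_sup[OF comp False] by blast
    have "m \<notin> C" using m(1) K assms by force
    then have "g m < 0" using m(1) K by (intro g_neg) auto
    then show thesis using m K by (intro that[of "- g m"]) auto
  qed
qed

text \<open>Disjoint windows put each lattice point into at most one of them. Each window is an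
  instance of the single-peak limit, and what remains is exponentially small.\<close>

lemma latticeSum_LIMSEQ:
  assumes F_bound: "\<And>N t. \<bar>F N t\<bar> \<le> B"
    and G_meas: "\<And>c. c \<in> C \<Longrightarrow> G c \<in> borel_measurable borel"
    and F_lim: "\<And>c. c \<in> C \<Longrightarrow> AE s in lborel. \<forall>x. x \<longlonglongrightarrow> s \<longrightarrow>
        (\<lambda>N. F N (c + x N * real N powr (- 1 / real r))) \<longlonglongrightarrow> G c s"
  shows "(\<lambda>N. latticeSum g F N / (sqrt (real N) * real N powr (- 1 / real r))) \<longlonglongrightarrow>
    1 / stirlingConst * (\<Sum>c\<in>C. 1 / sqrt (1 - c^2) * (\<integral>s. exp (- (A c * s ^ r)) * G c s \<partial>lborel))"
proof -
  obtain \<delta> where \<delta>: "\<delta> > 0"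
    "\<And>c u. c \<in> C \<Longrightarrow> \<bar>u\<bar> \<le> \<delta> \<Longrightarrow> g (c + u) \<le> - (A c / 2 * u ^ r)"
    "\<And>c. c \<in> C \<Longrightarrow> \<bar>c\<bar> + \<delta> < 1"
    "\<And>c c'. c \<in> C \<Longrightarrow> c' \<in> C \<Longrightarrow> c \<noteq> c' \<Longrightarrow> 2 * \<delta> < \<bar>c - c'\<bar>"
    by (rule separated_radius) blast
  obtain \<eta> where \<eta>: "\<eta> > 0" "\<And>t. t \<in> {-1..1} \<Longrightarrow> (\<And>c. c \<in> C \<Longrightarrow> \<delta> \<le> \<bar>t - c\<bar>) \<Longrightarrow> g t \<le> - \<eta>"
    using away_bound[OF \<delta>(1)] by blast
  define w where "w N k = binWeight N k * exp (real N * (g (grid N k) + Ient (grid N k))) * F N (grid N k)" for N k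
  define near where "near c N k = (if \<bar>grid N k - c\<bar> \<le> \<delta> then w N k else 0)" for c N k
  define far where "far N k = (if \<forall>c\<in>C. \<delta> < \<bar>grid N k - c\<bar> then w N k else 0)" for N k
  define \<nu> where "\<nu> N = sqrt (real N) * real N powr (- 1 / real r)" for N
  have split: "w N k = (\<Sum>c\<in>C. near c N k) + far N k" for N k
  proof (cases "\<forall>c\<in>C. \<delta> < \<bar>grid N k - c\<bar>")
    case True
    then have "(\<Sum>c\<in>C. near c N k) = 0" by (intro sum.neutral) (auto simp: near_def)
    then show ?thesis using True by (simp add: far_def)
  next
    case False
    then obtain c where c: "c \<in> C" "\<bar>grid N k - c\<bar> \<le> \<delta>" by force
    have "near c' N k = (if c' = c then w N k else 0)" if "c' \<in> C" for c'
      using \<delta>(4)[OF c(1) that] c(2) by (auto simp: near_def)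
    then have "(\<Sum>c'\<in>C. near c' N k) = w N k" using c finite_C by simp
    moreover have "far N k = 0" unfolding far_def using False by (rule if_not_P)
    ultimately show ?thesis by simp
  qed
  have near_lim: "(\<lambda>N. (\<Sum>k\<le>N. near c N k) / \<nu> N) \<longlonglongrightarrow>
      1 / stirlingConst * (1 / sqrt (1 - c^2) * (\<integral>s. exp (- (A c * s ^ r)) * G c s \<partial>lborel))"
    if c: "c \<in> C" for c
  proof -
    interpret peak g c \<delta> "A c" "A c / 2" r F "G c" B
      using even_r r_ge A_pos[OF c] \<delta> c expansion g_zero F_bound G_meas F_lim
      by unfold_locales auto
    show ?thesis using peak_sum unfolding near_def w_def summand_def \<nu>_def nu_def .
  qed
  have B0: "0 \<le> B" using F_bound[of 0 0] by linarith
  have \<nu>: "\<nu> N \<ge> 1" if "N > 0" for N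
  proof -
    have "\<nu> N = real N powr (1/2 + (- 1 / real r))"
      unfolding \<nu>_def powr_add using that by (simp add: powr_half_sqrt)
    then show ?thesis using that r_ge by (simp add: ge_one_powr_ge_zero field_simps)
  qed
  \<comment> \<open>There are at most N + 1 such terms, each bounded by B exp(-\<eta> N), and the
    normalization is at least 1 because r >= 2.\<close>
  have far_lim: "(\<lambda>N. (\<Sum>k\<le>N. far N k) / \<nu> N) \<longlonglongrightarrow> 0"
  proof (rule Lim_null_comparison)
    show "(\<lambda>N. (real N + 1) * (B * exp (- \<eta> * real N))) \<longlonglongrightarrow> 0"
      using \<eta>(1) by real_asymp
    show "eventually (\<lambda>N. norm ((\<Sum>k\<le>N. far N k) / \<nu> N) \<le> (real N + 1) * (B * exp (- \<eta> * real N))) sequentially"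
      using eventually_gt_at_top[of 0]
    proof eventually_elim
      case (elim N)
      have each: "\<bar>far N k\<bar> \<le> B * exp (- \<eta> * real N)" if k: "k \<le> N" for k
      proof (cases "\<forall>c\<in>C. \<delta> < \<bar>grid N k - c\<bar>")
        case True
        have gk: "grid N k \<in> {-1..1}" using grid_le_1[OF k] by (auto simp: abs_le_iff)
        have "g (grid N k) \<le> - \<eta>" using True gk by (intro \<eta>(2)) (auto intro: less_imp_le)
        then have 1: "real N * g (grid N k) \<le> - \<eta> * real N"
          using mult_left_mono[of "g (grid N k)" "- \<eta>" "real N"] by (simp add: mult.commute)
        have "binWeight N k * exp (real N * (g (grid N k) + Ient (grid N k)))
           \<le> exp (- (real N * Ient (grid N k))) * exp (real N * (g (grid N k) + Ient (grid N k)))"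
          using binWeight_le_exp[OF k elim] by (intro mult_right_mono) auto
        also have "\<dots> = exp (real N * g (grid N k))" by (simp add: algebra_simps flip: exp_add)
        also have "\<dots> \<le> exp (- \<eta> * real N)" using 1 by simp
        finally have "binWeight N k * exp (real N * (g (grid N k) + Ient (grid N k))) * \<bar>F N (grid N k)\<bar>
            \<le> exp (- \<eta> * real N) * B"
          using F_bound by (intro mult_mono) auto
        then show ?thesis using True binWeight_nonneg[of N k]
          by (simp add: far_def w_def abs_mult mult.commute)
      next
        case False
        then show ?thesis using B0 by (auto simp: far_def)
      qed
      have "\<bar>\<Sum>k\<le>N. far N k\<bar> \<le> (\<Sum>k\<le>N. B * exp (- \<eta> * real N))"
        using each by (intro order_trans[OF sum_abs] sum_mono) auto
      also have "\<dots> = (real N + 1) * (B * exp (- \<eta> * real N))" by simp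
      finally have "\<bar>\<Sum>k\<le>N. far N k\<bar> / \<nu> N \<le> (real N + 1) * (B * exp (- \<eta> * real N)) / 1"
        using \<nu>[OF elim] B0 by (intro frac_le) auto
      then show ?case using \<nu>[OF elim] by (simp add: abs_divide)
    qed
  qed
  have "(\<lambda>N. (\<Sum>c\<in>C. (\<Sum>k\<le>N. near c N k) / \<nu> N) + (\<Sum>k\<le>N. far N k) / \<nu> N) \<longlonglongrightarrow>
    (\<Sum>c\<in>C. 1 / stirlingConst * (1 / sqrt (1 - c^2) * (\<integral>s. exp (- (A c * s ^ r)) * G c s \<partial>lborel))) + 0"
    by (intro tendsto_add far_lim tendsto_sum near_lim)
  moreover have "(\<Sum>c\<in>C. (\<Sum>k\<le>N. near c N k) / \<nu> N) + (\<Sum>k\<le>N. far N k) / \<nu> N = latticeSum g F N / \<nu> N" for N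
  proof -
    have "latticeSum g F N = (\<Sum>k\<le>N. w N k)" by (simp add: latticeSum_def w_def)
    also have "\<dots> = (\<Sum>c\<in>C. \<Sum>k\<le>N. near c N k) + (\<Sum>k\<le>N. far N k)"
      unfolding split sum.distrib by (subst sum.swap) simp
    finally show ?thesis by (simp add: sum_divide_distrib add_divide_distrib)
  qed
  ultimately show ?thesis by (simp add: \<nu>_def sum_distrib_left)
qed

lemma latticeSum_ratio:
  assumes F_bound: "\<And>N t. \<bar>F N t\<bar> \<le> B"
    and G_meas: "\<And>c. c \<in> C \<Longrightarrow> G c \<in> borel_measurable borel"
    and F_lim: "\<And>c. c \<in> C \<Longrightarrow> AE s in lborel. \<forall>x. x \<longlonglongrightarrow> s \<longrightarrow>
        (\<lambda>N. F N (c + x N * real N powr (- 1 / real r))) \<longlonglongrightarrow> G c s"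
  shows "(\<lambda>N. latticeSum g F N / latticeSum g (\<lambda>_ _. 1) N) \<longlonglongrightarrow>
    (\<Sum>c\<in>C. 1 / sqrt (1 - c^2) * (\<integral>s. exp (- (A c * s ^ r)) * G c s \<partial>lborel)) /
    (\<Sum>c\<in>C. 1 / sqrt (1 - c^2) * (\<integral>s. exp (- (A c * s ^ r)) \<partial>lborel))"
proof -
  let ?n = "\<lambda>N. sqrt (real N) * real N powr (- 1 / real r)"
  define X where "X = (\<Sum>c\<in>C. 1 / sqrt (1 - c^2) * (\<integral>s. exp (- (A c * s ^ r)) * G c s \<partial>lborel))"
  define Y where "Y = (\<Sum>c\<in>C. 1 / sqrt (1 - c^2) * (\<integral>s. exp (- (A c * s ^ r)) \<partial>lborel))"
  have "Y > 0" unfolding Y_def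
  proof (intro sum_pos finite_C C_nonempty mult_pos_pos)
    fix c assume c: "c \<in> C"
    have "c^2 < 1" using C_inside[OF c] by (simp add: abs_square_less_1)
    then show "0 < 1 / sqrt (1 - c^2)" by simp
    show "0 < (\<integral>s. exp (- (A c * s ^ r)) \<partial>lborel)"
      by (rule integral_exp_neg_even_power_pos[OF even_r r_ge A_pos[OF c]])
  qed
  have "(\<lambda>N. latticeSum g F N / ?n N) \<longlonglongrightarrow> 1 / stirlingConst * X"
    unfolding X_def by (rule latticeSum_LIMSEQ[OF assms])
  moreover have "(\<lambda>N. latticeSum g (\<lambda>_ _. 1) N / ?n N) \<longlonglongrightarrow> 1 / stirlingConst * Y"
    using latticeSum_LIMSEQ[of "\<lambda>_ _. 1" 1 "\<lambda>_ _. 1"] unfolding Y_def by simp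
  ultimately have "(\<lambda>N. (latticeSum g F N / ?n N) / (latticeSum g (\<lambda>_ _. 1) N / ?n N)) \<longlonglongrightarrow>
      (1 / stirlingConst * X) / (1 / stirlingConst * Y)"
    using \<open>Y > 0\<close> stirlingConst_pos by (intro tendsto_divide) auto
  also have "(1 / stirlingConst * X) / (1 / stirlingConst * Y) = X / Y"
    using stirlingConst_pos by simp
  finally show ?thesis unfolding X_def Y_def
    by (rule Lim_transform_eventually) (rule eventually_mono[OF eventually_gt_at_top[of 0]], simp)
qed

end

subsection \<open>Reduction to the mean spin\<close>

text \<open>A configuration corresponds to the set of its +1 sites, and the total spin depends only
  on the cardinality of that set.\<close>

lemma sum_conf_eq_binomial_sum:
  "(\<Sum>x\<in>conf N. \<phi> (\<Sum>i<N. x i)) = (\<Sum>k\<le>N. real (N choose k) * \<phi> (2 * real k - real N))"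
proof -
  define X where "X S = (\<lambda>i\<in>{..<N}. if i \<in> S then 1 else (-1::real))" for S
  have bij: "bij_betw X (Pow {..<N}) (conf N)"
  proof (rule bij_betwI[where g = "\<lambda>x. {i\<in>{..<N}. x i = 1}"])
    show "X \<in> Pow {..<N} \<rightarrow> conf N" by (auto simp: X_def conf_def)
    show "(\<lambda>x. {i\<in>{..<N}. x i = 1}) \<in> conf N \<rightarrow> Pow {..<N}" by auto
    show "{i \<in> {..<N}. X S i = 1} = S" if "S \<in> Pow {..<N}" for S
      using that by (auto simp: X_def split: if_splits)
    show "X {i \<in> {..<N}. x i = 1} = x" if "x \<in> conf N" for x
    proof
      fix i
      have "i < N \<Longrightarrow> x i = 1 \<or> x i = -1" "\<not> i < N \<Longrightarrow> x i = undefined"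
        using that by (auto simp: conf_def PiE_iff extensional_def)
      then show "X {i \<in> {..<N}. x i = 1} i = x i" by (auto simp: X_def)
    qed
  qed
  have sumX: "(\<Sum>i<N. X S i) = 2 * real (card S) - real N" if "S \<in> Pow {..<N}" for S
  proof -
    have fin: "finite S" using that finite_subset by auto
    have "(\<Sum>i<N. X S i) = (\<Sum>i<N. 2 * of_bool (i \<in> S) - 1)"
      by (intro sum.cong) (auto simp: X_def)
    also have "\<dots> = 2 * (\<Sum>i<N. of_bool (i \<in> S)) - real N"
      by (simp add: sum_subtractf sum_distrib_left)
    also have "(\<Sum>i<N. of_bool (i \<in> S)) = real (card ({..<N} \<inter> S))"
      by (simp add: of_bool_def sum.If_cases Int_def)
    also have "{..<N} \<inter> S = S" using that by auto
    finally show ?thesis .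
  qed
  have "(\<Sum>x\<in>conf N. \<phi> (\<Sum>i<N. x i)) = (\<Sum>S\<in>Pow {..<N}. \<phi> (\<Sum>i<N. X S i))"
    by (rule sum.reindex_bij_betw[OF bij, symmetric])
  also have "\<dots> = (\<Sum>S\<in>Pow {..<N}. \<phi> (2 * real (card S) - real N))"
    by (intro sum.cong refl) (simp add: sumX)
  also have "\<dots> = (\<Sum>k\<le>N. \<Sum>S\<in>{S \<in> Pow {..<N}. card S = k}. \<phi> (2 * real (card S) - real N))"
    by (rule sum.group[symmetric]) (auto intro: card_mono[of "{..<N}", simplified])
  also have "\<dots> = (\<Sum>k\<le>N. \<Sum>S\<in>{S \<in> Pow {..<N}. card S = k}. \<phi> (2 * real k - real N))"
    by (intro sum.cong) auto
  also have "\<dots> = (\<Sum>k\<le>N. real (N choose k) * \<phi> (2 * real k - real N))"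
    using n_subsets[of "{..<N}"] by simp
  finally show ?thesis .
qed

definition mean :: "nat \<Rightarrow> (nat \<Rightarrow> real) \<Rightarrow> real" where
  "mean N x = (\<Sum>i<N. x i) / real N"

text \<open>The couplings are constant and repeated indices are allowed, so the sum over index
  tuples factors exactly into a power of the total spin, with no correction terms.\<close>

lemma HN_eq_mean:
  assumes "N > 0" "p \<ge> 1"
  shows "HN p N x = real N * mean N x ^ p"
proof -
  have "HN p N x = 1 / real N ^ (p - 1) * (\<Prod>k<p. \<Sum>i<N. x i)"
    unfolding HN_def by (subst prod_sum_PiE) (auto simp: sum_distrib_left)
  also have "\<dots> = real N * mean N x ^ p"
    using assms by (cases p) (auto simp: mean_def power_divide field_simps)
  finally show ?thesis .
qed

lemma mloc_eq_mean:
  assumes "N > 0"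
  shows "mloc p N x i = mean N x ^ (p - 1)"
proof -
  have "mloc p N x i = 1 / real N ^ (p - 1) * (\<Prod>k\<in>{1..<p}. \<Sum>i<N. x i)"
    unfolding mloc_def by (subst prod_sum_PiE) (auto simp: sum_distrib_left)
  also have "\<dots> = mean N x ^ (p - 1)"
    by (simp add: mean_def power_divide)
  finally show ?thesis .
qed

text \<open>The estimating equation at mean spin t, after dividing both sides by their common factor
  N.\<close>

definition mpleMean :: "nat \<Rightarrow> real \<Rightarrow> ereal" where
  "mpleMean p t = Inf (ereal ` {b. 0 \<le> b \<and> t ^ p = t ^ (p - 1) * tanh (real p * b * t ^ (p - 1))})"

lemma mple_eq_mpleMean:
  assumes "N > 0" "p \<ge> 1"
  shows "mple p N x = mpleMean p (mean N x)"
  unfolding mple_def mpleMean_def using assms by (simp add: HN_eq_mean mloc_eq_mean)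

section \<open>Explicit solution of the estimating equation\<close>

lemma tanh_artanh_real:
  assumes "\<bar>t\<bar> < (1::real)"
  shows "tanh (artanh t) = t"
proof -
  have e: "exp (2 * artanh t) = (1 + t) / (1 - t)"
    using assms by (simp add: artanh_def abs_less_iff)
  have "tanh (artanh t) = (1 - exp (- 2 * artanh t)) / (1 + exp (- 2 * artanh t))"
    by (rule tanh_real_altdef)
  also have "exp (- 2 * artanh t) = (1 - t) / (1 + t)"
    using e by (simp add: exp_minus field_simps)
  also have "(1 - (1 - t) / (1 + t)) / (1 + (1 - t) / (1 + t)) = t"
    using assms by (simp add: field_simps abs_less_iff)
  finally show ?thesis .
qed

text \<open>Cancelling t^(p-1) leaves t = tanh(...), and injectivity of tanh gives one real root
  \<open>b0\<close>; a negative root leaves the admissible set empty. The exclusions are harmless: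
  near the peaks t is eventually inside (-1, 1), and nonzero unless the rescaled coordinate tends to
  0, a single point.\<close>

lemma mpleMean_eq:
  assumes t: "t \<noteq> 0" "\<bar>t\<bar> < 1" and p: "p \<ge> 1"
  shows "mpleMean p t = (if artanh t / t ^ (p - 1) \<ge> 0 then ereal (artanh t / (real p * t ^ (p - 1))) else \<infinity>)"
proof -
  define b0 where "b0 = artanh t / (real p * t ^ (p - 1))"
  have "t ^ p = t ^ (p - 1) * tanh (real p * b * t ^ (p - 1)) \<longleftrightarrow> b = b0" for b
  proof -
    have "t ^ p = t ^ (p - 1) * t" using p by (cases p) auto
    then have "t ^ p = t ^ (p - 1) * tanh (real p * b * t ^ (p - 1)) \<longleftrightarrow> t = tanh (real p * b * t ^ (p - 1))"
      using t by simp
    also have "\<dots> \<longleftrightarrow> artanh t = real p * b * t ^ (p - 1)"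
      using tanh_artanh_real[OF t(2)] artanh_tanh_real by metis
    also have "\<dots> \<longleftrightarrow> b = b0" using t p by (auto simp: b0_def field_simps)
    finally show ?thesis .
  qed
  then have "{b. 0 \<le> b \<and> t ^ p = t ^ (p - 1) * tanh (real p * b * t ^ (p - 1))} = (if b0 \<ge> 0 then {b0} else {})"
    by auto
  moreover have "b0 \<ge> 0 \<longleftrightarrow> artanh t / t ^ (p - 1) \<ge> 0"
  proof -
    have "b0 = (artanh t / t ^ (p - 1)) / real p" by (simp add: b0_def)
    then show ?thesis using p by (simp only: zero_le_divide_iff) auto
  qed
  ultimately show ?thesis unfolding mpleMean_def by (simp add: b0_def top_ereal_def)
qed

text \<open>For odd p - 1 the signs of t^(p-1) and of tanh change together, so the estimating
  equation is unchanged.\<close>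

lemma mpleMean_minus_even:
  assumes "even p" "p \<ge> 1"
  shows "mpleMean p (- t) = mpleMean p t"
proof -
  have "odd (p - 1)" using assms by simp
  then show ?thesis using assms unfolding mpleMean_def by simp
qed

lemma artanh_div_self_LIMSEQ:
  "((\<lambda>t. artanh t / t) \<longlongrightarrow> (1::real)) (at 0)"
proof -
  have "(artanh has_real_derivative 1 / (1 - 0^2)) (at (0::real))"
    by (rule artanh_real_has_field_derivative) simp
  then show ?thesis by (simp add: DERIV_def)
qed

lemma artanh_pos_iff:
  assumes "\<bar>t\<bar> < (1::real)" "t > 0"
  shows "artanh t > 0"
  using assms by (simp add: artanh_def abs_less_iff)

lemma cwE_eq_latticeSum_ratio:
  assumes N: "N > 0" and p: "p \<ge> 1" and f: "\<And>x. x \<in> conf N \<Longrightarrow> f x = F N (mean N x)"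
  shows "cwE p (betaCW p) N f = latticeSum (gCW p) F N / latticeSum (gCW p) (\<lambda>_ _. 1) N"
proof -
  have *: "(\<Sum>x\<in>conf N. exp (betaCW p * HN p N x) * H N (mean N x)) = 2 ^ N * latticeSum (gCW p) H N"
    for H :: "nat \<Rightarrow> real \<Rightarrow> real"
  proof -
    define \<phi> where "\<phi> y = exp (real N * (betaCW p * (y / real N) ^ p)) * H N (y / real N)" for y
    have "(\<Sum>x\<in>conf N. exp (betaCW p * HN p N x) * H N (mean N x)) = (\<Sum>x\<in>conf N. \<phi> (\<Sum>i<N. x i))"
      using N p by (intro sum.cong) (auto simp: \<phi>_def HN_eq_mean mean_def mult_ac)
    also have "\<dots> = (\<Sum>k\<le>N. real (N choose k) * \<phi> (2 * real k - real N))"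
      by (rule sum_conf_eq_binomial_sum)
    also have "\<dots> = 2 ^ N * latticeSum (gCW p) H N"
      unfolding latticeSum_def sum_distrib_left
      by (intro sum.cong) (auto simp: \<phi>_def grid_def gCW_def binWeight_def)
    finally show ?thesis .
  qed
  have "(\<Sum>x\<in>conf N. exp (betaCW p * HN p N x) * f x) = 2 ^ N * latticeSum (gCW p) F N"
    unfolding *[symmetric] using f by (intro sum.cong) auto
  moreover have "(\<Sum>x\<in>conf N. exp (betaCW p * HN p N x)) = 2 ^ N * latticeSum (gCW p) (\<lambda>_ _. 1) N"
    using *[of "\<lambda>_ _. 1"] by simp
  ultimately show ?thesis unfolding cwE_def by simp
qed

subsection \<open>The peaks of the Curie--Weiss weights\<close>

lemma peaks_gCW_2: "peaks (gCW 2) {0} (\<lambda>_. 1/12) 4"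
proof
  show "((\<lambda>u. gCW 2 (c + u) / u ^ 4) \<longlongrightarrow> - (1/12)) (at 0)" if "c \<in> {0}" for c
    using gCW_2_expansion that by simp
  show "gCW 2 t < 0" if "t \<in> {-1..1}" "t \<notin> {0}" for t
    using gCW_2_neg[of t] that by (auto simp: abs_le_iff)
qed (auto simp: continuous_on_gCW)

definition curv :: "nat \<Rightarrow> real" where
  "curv p = - deriv (deriv (gCW p)) (mstar p)"

definition peakSet :: "nat \<Rightarrow> real set" where
  "peakSet p = (if even p then {0, mstar p, - mstar p} else {0, mstar p})"

lemma peaks_gCW:
  assumes p: "p \<ge> 3"
  shows "peaks (gCW p) (peakSet p) (\<lambda>c. if c = 0 then 1/2 else curv p / 2) 2"
proof
  note P = mstar_properties[OF p]
  have C: "c = 0 \<or> c = mstar p \<or> (even p \<and> c = - mstar p)" if "c \<in> peakSet p" for c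
    using that by (auto simp: peakSet_def split: if_splits)
  show "finite (peakSet p)" "peakSet p \<noteq> {}" by (auto simp: peakSet_def)
  show "\<bar>c\<bar> < 1" if "c \<in> peakSet p" for c using C[OF that] P(1,2) by auto
  show "0 < (if c = 0 then 1/2 else curv p / 2)" for c using P(5) by (simp add: curv_def)
  show "gCW p c = 0" if "c \<in> peakSet p" for c
    using C[OF that] P(3) p gCW_minus_even[of p "mstar p"] by auto
  show "gCW p t < 0" if t: "t \<in> {-1..1}" "t \<notin> peakSet p" for t
  proof (cases "t \<ge> 0")
    case True
    then show ?thesis using t P(9)[of t] by (auto simp: peakSet_def split: if_splits)
  next
    case False
    show ?thesis
    proof (cases "even p")
      case True
      then have "gCW p t = gCW p (- t)" by (simp add: gCW_minus_even)
      then show ?thesis using t P(9)[of "- t"] False True by (auto simp: peakSet_def)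
    next
      case odd: False
      then show ?thesis using False t p by (intro gCW_neg_odd) auto
    qed
  qed
  show "((\<lambda>u. gCW p (c + u) / u ^ 2) \<longlongrightarrow> - (if c = 0 then 1/2 else curv p / 2)) (at 0)"
    if "c \<in> peakSet p" for c
    using C[OF that] gCW_expansion_0[OF p] gCW_expansion_mstar[OF p] gCW_expansion_minus_mstar[OF p] P(1)
    by (auto simp: curv_def)
qed (auto simp: continuous_on_gCW)

subsection \<open>Gaussian integrals\<close>

text \<open>Here s is the rescaled deviation of the mean spin, with variance 1/v, and \<kappa> is
  the slope of a linear image; the right-hand side is an expectation under the law of that
  image.\<close>

lemma integral_exp_square_substitution:
  assumes "v > 0" "\<kappa> > 0"
  shows "(\<integral>s. exp (- (v / 2 * s^2)) * \<phi> (\<kappa> * s) \<partial>lborel)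
    = sqrt (2 * pi / v) * (\<integral>z. normal_density 0 (\<kappa> / sqrt v) z * \<phi> z \<partial>lborel)"
proof -
  have nd: "normal_density 0 (\<kappa> / sqrt v) (\<kappa> * s) = sqrt v / (\<kappa> * sqrt (2 * pi)) * exp (- (v / 2 * s^2))" for s
    using assms by (simp add: normal_density_def power_mult_distrib power_divide real_sqrt_mult real_sqrt_divide field_simps)
  have "(\<integral>z. normal_density 0 (\<kappa> / sqrt v) z * \<phi> z \<partial>lborel)
     = \<kappa> * (\<integral>s. normal_density 0 (\<kappa> / sqrt v) (\<kappa> * s) * \<phi> (\<kappa> * s) \<partial>lborel)"
    using lborel_integral_real_affine[of \<kappa> "\<lambda>z. normal_density 0 (\<kappa> / sqrt v) z * \<phi> z" 0] assms by simp
  also have "\<dots> = \<kappa> * (sqrt v / (\<kappa> * sqrt (2 * pi)) * (\<integral>s. exp (- (v / 2 * s^2)) * \<phi> (\<kappa> * s) \<partial>lborel))"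
    unfolding nd by (simp only: mult.assoc integral_mult_right_zero)
  finally show ?thesis using assms by (simp add: real_sqrt_divide)
qed

lemma integral_exp_square:
  assumes "v > 0"
  shows "(\<integral>s. exp (- (v / 2 * s^2)) \<partial>lborel) = sqrt (2 * pi / v)"
  using integral_exp_square_substitution[OF assms, of 1 "\<lambda>_. 1"] assms by simp

lemma integral_reflect_real:
  "(\<integral>s. \<phi> (- s) \<partial>lborel) = (\<integral>s. \<phi> s \<partial>lborel)" for \<phi> :: "real \<Rightarrow> real"
  using lborel_integral_real_affine[of "-1" \<phi> 0] by simp

subsection \<open>Limits along a general functional of the estimate\<close>

lemma powr_neg_half: "real N powr (- 1 / real 2) = 1 / sqrt (real N)"
  by (cases "N = 0") (simp_all add: powr_minus powr_half_sqrt field_simps)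

text \<open>The common form of all laws for p >= 3; it remains to supply the limit of the rescaled
  estimate at each peak. The point s = 0 is left out of \<open>lim0\<close> because the estimate is
  singular there and a point is null.\<close>

lemma cwE_mple_LIMSEQ:
  assumes p: "p \<ge> 3"
    and H_bound: "\<And>N b. \<bar>H N b\<bar> \<le> B"
    and [measurable]: "G0 \<in> borel_measurable borel" "Gm \<in> borel_measurable borel"
    and lim0: "\<And>s x. s \<noteq> 0 \<Longrightarrow> x \<longlonglongrightarrow> s \<Longrightarrow> (\<lambda>N. H N (mpleMean p (x N / sqrt (real N)))) \<longlonglongrightarrow> G0 s"
    and limm: "\<And>s x. x \<longlonglongrightarrow> s \<Longrightarrow> (\<lambda>N. H N (mpleMean p (mstar p + x N / sqrt (real N)))) \<longlonglongrightarrow> Gm s"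
  shows "(\<lambda>N. cwE p (betaCW p) N (\<lambda>x. H N (mple p N x))) \<longlonglongrightarrow>
      alphaCW p * ((\<integral>s. exp (- (1 / 2 * s^2)) * G0 s \<partial>lborel) / sqrt (2 * pi)) +
      (1 - alphaCW p) * ((\<integral>s. exp (- (curv p / 2 * s^2)) * Gm s \<partial>lborel) / sqrt (2 * pi / curv p))"
proof -
  note P = mstar_properties[OF p]
  interpret peaks "gCW p" "peakSet p" "\<lambda>c. if c = 0 then 1/2 else curv p / 2" 2
    by (rule peaks_gCW[OF p])
  define F where "F N t = H N (mpleMean p t)" for N t
  \<comment> \<open>For even p the estimate is even in the mean spin, so the peak at
    \<open>- mstar p\<close> sees the limit at \<open>mstar p\<close> with s reflected.\<close>
  define G where "G c s = (if c = 0 then G0 s else if c > 0 then Gm s else Gm (- s))" for c s :: real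
  have C: "c = 0 \<or> c = mstar p \<or> (even p \<and> c = - mstar p)" if "c \<in> peakSet p" for c
    using that by (auto simp: peakSet_def split: if_splits)
  have lim: "(\<lambda>N. latticeSum (gCW p) F N / latticeSum (gCW p) (\<lambda>_ _. 1) N) \<longlonglongrightarrow>
    (\<Sum>c\<in>peakSet p. 1 / sqrt (1 - c^2) * (\<integral>s. exp (- ((if c = 0 then 1/2 else curv p / 2) * s^2)) * G c s \<partial>lborel)) /
    (\<Sum>c\<in>peakSet p. 1 / sqrt (1 - c^2) * (\<integral>s. exp (- ((if c = 0 then 1/2 else curv p / 2) * s^2)) \<partial>lborel))"
  proof (rule latticeSum_ratio)
    show "\<bar>F N t\<bar> \<le> B" for N t by (simp add: F_def H_bound)
    show "G c \<in> borel_measurable borel" for c unfolding G_def by measurable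
    fix c assume "c \<in> peakSet p"
    then consider "c = 0" | "c = mstar p" | "even p" "c = - mstar p" using C by blast
    then show "AE s in lborel. \<forall>x. x \<longlonglongrightarrow> s \<longrightarrow>
        (\<lambda>N. F N (c + x N * real N powr (- 1 / real 2))) \<longlonglongrightarrow> G c s"
    proof cases
      case 1
      have "AE s in lborel. s \<noteq> (0::real)" by (rule AE_lborel_singleton)
      then show ?thesis
      proof eventually_elim
        case (elim s)
        then show ?case using lim0[of s] 1 unfolding powr_neg_half by (simp add: F_def G_def)
      qed
    next
      case 2
      then show ?thesis using limm P(1) unfolding powr_neg_half by (simp add: F_def G_def)
    next
      case 3
      have "(\<lambda>N. F N (c + x N * (1 / sqrt (real N)))) \<longlonglongrightarrow> G c s" if x: "x \<longlonglongrightarrow> s" for x s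
      proof -
        have "mpleMean p (c + x N * (1 / sqrt (real N))) = mpleMean p (mstar p + (- x N) / sqrt (real N))" for N
          using mpleMean_minus_even[of p "mstar p + (- x N) / sqrt (real N)"] 3 p by (simp add: algebra_simps)
        then show ?thesis using limm[OF tendsto_minus[OF x]] 3 P(1) by (simp add: F_def G_def)
      qed
      then show ?thesis unfolding powr_neg_half by simp
    qed
  qed
  define E0 where "E0 = (\<integral>s. exp (- (1 / 2 * s^2)) * G0 s \<partial>lborel)"
  define Em where "Em = (\<integral>s. exp (- (curv p / 2 * s^2)) * Gm s \<partial>lborel)"
  define v where "v = curv p"
  define m where "m = mstar p"
  \<comment> \<open>The number of nonzero peaks. By reflection the two peaks for even p contribute
    equally, which is the source of the 2 in \<open>alphaCW\<close>.\<close>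
  define K where "K = (if even p then 2 else 1 :: real)"
  have v: "v > 0" using P(5) by (simp add: v_def curv_def)
  have m: "m > 0" "m^2 < 1" using P(1,2) by (auto simp: m_def abs_square_less_1)
  have refl: "(\<integral>s. exp (- (curv p / 2 * s^2)) * Gm (- s) \<partial>lborel) = Em"
    using integral_reflect_real[of "\<lambda>s. exp (- (curv p / 2 * s^2)) * Gm s"] by (simp add: Em_def)
  have sum: "(\<Sum>c\<in>peakSet p. h c) = h 0 + K * h m" if "even p \<Longrightarrow> h (- m) = h m" for h :: "real \<Rightarrow> real"
    using m that by (simp add: peakSet_def K_def m_def)
  have num: "(\<Sum>c\<in>peakSet p. 1 / sqrt (1 - c^2) * (\<integral>s. exp (- ((if c = 0 then 1/2 else curv p / 2) * s^2)) * G c s \<partial>lborel))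
      = E0 + K * (1 / sqrt (1 - m^2) * Em)"
    using m refl by (subst sum) (auto simp: G_def E0_def Em_def)
  have den: "(\<Sum>c\<in>peakSet p. 1 / sqrt (1 - c^2) * (\<integral>s. exp (- ((if c = 0 then 1/2 else curv p / 2) * s^2)) \<partial>lborel))
      = sqrt (2 * pi) + K * (1 / sqrt (1 - m^2) * sqrt (2 * pi / v))"
    using m integral_exp_square[of 1] integral_exp_square[OF v] by (subst sum) (auto simp: v_def)
  define S where "S = sqrt (1 - m^2) * sqrt v"
  have S: "S > 0" using m v by (simp add: S_def)
  have alpha: "alphaCW p = 1 / (1 + K / S)"
  proof -
    have "((mstar p)\<^sup>2 - 1) * deriv (deriv (gCW p)) (mstar p) = (1 - m^2) * v"
      by (simp add: m_def v_def curv_def algebra_simps)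
    then show ?thesis by (simp add: alphaCW_def Let_def S_def K_def real_sqrt_mult)
  qed
  have "(E0 + K * (1 / sqrt (1 - m^2) * Em)) / (sqrt (2 * pi) + K * (1 / sqrt (1 - m^2) * sqrt (2 * pi / v)))
     = alphaCW p * (E0 / sqrt (2 * pi)) + (1 - alphaCW p) * (Em / sqrt (2 * pi / v))"
  proof -
    \<comment> \<open>The Gaussian mass is w at 0, and w / y with extra weight 1 / z at each nonzero
      peak; the share of the peak at 0 is therefore z y / (z y + K).\<close>
    define w where "w = sqrt (2 * pi)"
    define y where "y = sqrt v"
    define z where "z = sqrt (1 - m^2)"
    have pos: "w > 0" "y > 0" "z > 0" using m v by (auto simp: w_def y_def z_def)
    have K: "K > 0" by (simp add: K_def)
    have D: "z * y + K > 0" using pos K by (simp add: add_pos_pos)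
    have 1: "sqrt (2 * pi / v) = w / y" by (simp add: w_def y_def real_sqrt_divide)
    have a: "alphaCW p = z * y / (z * y + K)"
      unfolding alpha S_def using pos K by (simp add: field_simps flip: y_def z_def)
    have a': "1 - alphaCW p = K / (z * y + K)"
      unfolding a using D by (simp add: field_simps)
    have "w + K * (1 / z * (w / y)) = w * (z * y + K) / (z * y)"
      using pos by (simp add: field_simps)
    then have "(E0 + K * (1 / z * Em)) / (w + K * (1 / z * (w / y))) = (E0 + K * (1 / z * Em)) * (z * y) / (w * (z * y + K))"
      by simp
    also have "(E0 + K * (1 / z * Em)) * (z * y) = z * y * E0 + K * (y * Em)"
      using pos by (simp add: field_simps)
    also have "(z * y * E0 + K * (y * Em)) / (w * (z * y + K)) = z * y / (z * y + K) * (E0 / w) + K / (z * y + K) * (Em / (w / y))"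
      using pos D by (simp add: add_divide_distrib mult_ac)
    finally show ?thesis unfolding 1 a' unfolding a by (simp only: w_def z_def)
  qed
  then have lim': "(\<lambda>N. latticeSum (gCW p) F N / latticeSum (gCW p) (\<lambda>_ _. 1) N) \<longlonglongrightarrow>
      alphaCW p * (E0 / sqrt (2 * pi)) + (1 - alphaCW p) * (Em / sqrt (2 * pi / v))"
    using lim unfolding num den by simp
  show ?thesis unfolding E0_def[symmetric] Em_def[symmetric] unfolding v_def[symmetric]
  proof (rule Lim_transform_eventually[OF lim'])
    show "eventually (\<lambda>N. latticeSum (gCW p) F N / latticeSum (gCW p) (\<lambda>_ _. 1) N
        = cwE p (betaCW p) N (\<lambda>x. H N (mple p N x))) sequentially"
      using eventually_gt_at_top[of 0]
    proof eventually_elim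
      case (elim N)
      show ?case
        by (rule cwE_eq_latticeSum_ratio[symmetric]) (use elim p in \<open>auto simp: F_def mple_eq_mpleMean\<close>)
    qed
  qed
qed

subsection \<open>The estimate near the peaks\<close>

lemma div_sqrt_LIMSEQ_0:
  assumes "x \<longlonglongrightarrow> s"
  shows "(\<lambda>N. x N / sqrt (real N)) \<longlonglongrightarrow> 0"
proof -
  have "(\<lambda>N. 1 / sqrt (real N)) \<longlonglongrightarrow> 0" by real_asymp
  from tendsto_mult[OF assms this] show ?thesis by simp
qed

context
  fixes p :: nat and x :: "nat \<Rightarrow> real" and s :: real
  assumes p: "p \<ge> 3" and x: "x \<longlonglongrightarrow> s"
begin

lemma near_zero_eventually:
  assumes "s \<noteq> 0"
  shows "eventually (\<lambda>N. N > 0 \<and> x N / sqrt (real N) \<noteq> 0 \<and> \<bar>x N / sqrt (real N)\<bar> < 1 \<and> sgn (x N) = sgn s) sequentially"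
proof -
  have "eventually (\<lambda>N. sgn (x N) = sgn s) sequentially"
  proof (cases "s > 0")
    case True
    then show ?thesis using order_tendstoD(1)[OF x True] by (auto elim!: eventually_mono)
  next
    case False
    then have "s < 0" using assms by simp
    then show ?thesis using order_tendstoD(2)[OF x \<open>s < 0\<close>] by (auto elim!: eventually_mono)
  qed
  moreover have "eventually (\<lambda>N. \<bar>x N / sqrt (real N)\<bar> < 1) sequentially"
    using tendstoD[OF div_sqrt_LIMSEQ_0[OF x], of 1] by (simp add: dist_real_def)
  ultimately show ?thesis using eventually_gt_at_top[of 0]
    by eventually_elim (use assms in \<open>auto simp: sgn_if split: if_splits\<close>)
qed

text \<open>The estimate splits as artanh t / t, which tends to 1, times 1 / (p t^(p-2)) with t = x
  / sqrt N. The second factor grows like N^((p-2)/2), so the estimate is of that order and no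
  centering \<open>\<beta>\<close> can compensate it.\<close>

lemma near_zero_mple:
  assumes s: "s \<noteq> 0" "s > 0 \<or> even p"
  shows "(\<lambda>N. ereal (real N powr (1 - real p / 2)) * mpleMean p (x N / sqrt (real N)))
           \<longlonglongrightarrow> ereal (1 / (real p * s ^ (p - 2)))"
    and "(\<lambda>N. ereal (sqrt (real N)) * (mpleMean p (x N / sqrt (real N)) - ereal \<beta>)) \<longlonglongrightarrow> \<infinity>"
proof -
  obtain q where q: "p = q + 2" "q > 0" using p by (intro that[of "p - 2"]) auto
  define t where "t N = x N / sqrt (real N)" for N
  \<comment> \<open>The estimate without its growth factor \<open>sqrt (real N) ^ q\<close>; this
    part converges.\<close>
  define u where "u N = artanh (t N) / t N * (1 / (real p * x N ^ q))" for N
  have sq: "s ^ q > 0" using s q by (auto simp: zero_less_power_eq)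
  have ev: "eventually (\<lambda>N. N > 0 \<and> t N \<noteq> 0 \<and> \<bar>t N\<bar> < 1 \<and> (x N > 0 \<or> even p)) sequentially"
    using near_zero_eventually[OF s(1)] s unfolding t_def
    by (auto elim!: eventually_mono simp: sgn_if split: if_splits)
  have "t \<longlonglongrightarrow> 0" using div_sqrt_LIMSEQ_0[OF x] by (simp add: t_def [abs_def])
  then have "filterlim t (at 0) sequentially"
    unfolding filterlim_at using ev by (auto elim!: eventually_mono)
  then have "(\<lambda>N. artanh (t N) / t N) \<longlonglongrightarrow> 1"
    by (rule filterlim_compose[OF artanh_div_self_LIMSEQ])
  then have ulim: "u \<longlonglongrightarrow> 1 * (1 / (real p * s ^ q))"
    unfolding u_def using s p by (intro tendsto_intros x) auto
  have h: "mpleMean p (t N) = ereal (u N * sqrt (real N) ^ q)"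
    if N: "N > 0" "t N \<noteq> 0" "\<bar>t N\<bar> < 1" "x N > 0 \<or> even p" for N
  proof -
    have tq: "t N ^ (p - 1) = t N * t N ^ q" by (simp add: q)
    have "artanh (t N) / t N > 0"
    proof (cases "t N > 0")
      case True
      then show ?thesis using artanh_pos_iff[of "t N"] N by simp
    next
      case False
      then show ?thesis using artanh_pos_iff[of "- t N"] N by (simp add: zero_less_divide_iff)
    qed
    moreover have "t N ^ q > 0"
      using N by (auto simp: t_def q zero_less_power_eq)
    ultimately have "0 < artanh (t N) / t N / t N ^ q" by (rule divide_pos_pos)
    then have "artanh (t N) / t N ^ (p - 1) \<ge> 0" unfolding tq by simp
    then have "mpleMean p (t N) = ereal (artanh (t N) / (real p * t N ^ (p - 1)))"
      using mpleMean_eq[of "t N" p] N p by simp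
    also have "artanh (t N) / (real p * t N ^ (p - 1)) = artanh (t N) / t N * (1 / (real p * t N ^ q))"
      unfolding tq by simp
    also have "1 / (real p * t N ^ q) = 1 / (real p * x N ^ q) * sqrt (real N) ^ q"
      using N by (simp add: t_def power_divide)
    finally show ?thesis by (simp add: u_def)
  qed
  show "(\<lambda>N. ereal (real N powr (1 - real p / 2)) * mpleMean p (x N / sqrt (real N)))
           \<longlonglongrightarrow> ereal (1 / (real p * s ^ (p - 2)))"
  proof (rule Lim_transform_eventually)
    show "(\<lambda>N. ereal (u N)) \<longlonglongrightarrow> ereal (1 / (real p * s ^ (p - 2)))"
      using ulim by (intro tendsto_ereal) (simp add: q)
    show "eventually (\<lambda>N. ereal (u N) = ereal (real N powr (1 - real p / 2)) * mpleMean p (x N / sqrt (real N))) sequentially"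
      using ev
    proof eventually_elim
      case (elim N)
      have "real N powr (1 - real p / 2) * sqrt (real N) ^ q = 1"
      proof -
        have "sqrt (real N) ^ q = real N powr (real q / 2)"
          using elim by (simp add: powr_half_sqrt[symmetric] powr_powr flip: powr_realpow)
        then have "real N powr (1 - real p / 2) * sqrt (real N) ^ q = real N powr (1 - real p / 2 + real q / 2)"
          by (simp only: powr_add)
        also have "1 - real p / 2 + real q / 2 = 0" by (simp add: q add_divide_distrib)
        finally show ?thesis using elim by simp
      qed
      then have "u N = real N powr (1 - real p / 2) * (u N * sqrt (real N) ^ q)"
        by (simp add: mult.left_commute)
      then show ?case using h[of N] elim unfolding t_def[symmetric] by simp
    qed
  qed
  show "(\<lambda>N. ereal (sqrt (real N)) * (mpleMean p (x N / sqrt (real N)) - ereal \<beta>)) \<longlonglongrightarrow> \<infinity>"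
  proof (rule Lim_transform_eventually)
    have r: "filterlim (\<lambda>N. sqrt (real N)) at_top sequentially" by real_asymp
    have "filterlim (\<lambda>N. sqrt (real N) ^ q) at_top sequentially"
      by (rule filterlim_pow_at_top[OF q(2) r])
    then have "filterlim (\<lambda>N. u N * sqrt (real N) ^ q) at_top sequentially"
      using sq p by (intro filterlim_tendsto_pos_mult_at_top[OF ulim]) auto
    then have "filterlim (\<lambda>N. - \<beta> + u N * sqrt (real N) ^ q) at_top sequentially"
      by (rule filterlim_tendsto_add_at_top[OF tendsto_const])
    then have "filterlim (\<lambda>N. sqrt (real N) * (- \<beta> + u N * sqrt (real N) ^ q)) at_top sequentially"
      by (rule filterlim_at_top_mult_at_top[OF r])
    then show "(\<lambda>N. ereal (sqrt (real N) * (- \<beta> + u N * sqrt (real N) ^ q))) \<longlonglongrightarrow> \<infinity>"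
      by (simp add: tendsto_PInfty_eq_at_top)
    show "eventually (\<lambda>N. ereal (sqrt (real N) * (- \<beta> + u N * sqrt (real N) ^ q))
       = ereal (sqrt (real N)) * (mpleMean p (x N / sqrt (real N)) - ereal \<beta>)) sequentially"
      using ev by eventually_elim (use h in \<open>simp add: t_def[symmetric]\<close>)
  qed
qed

text \<open>For odd p the power t^(p-1) is positive while artanh t is negative. The only root is
  then negative, and the estimate equals infinity for all large N rather than merely
  diverging.\<close>

lemma near_zero_mple_negative:
  assumes s: "s < 0" "odd p"
  shows "(\<lambda>N. ereal (real N powr (1 - real p / 2)) * mpleMean p (x N / sqrt (real N))) \<longlonglongrightarrow> \<infinity>"
    and "(\<lambda>N. ereal (sqrt (real N)) * (mpleMean p (x N / sqrt (real N)) - ereal \<beta>)) \<longlonglongrightarrow> \<infinity>"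
proof -
  have ev: "eventually (\<lambda>N. N > 0 \<and> mpleMean p (x N / sqrt (real N)) = \<infinity>) sequentially"
    using near_zero_eventually[OF less_imp_neq[OF s(1)]]
  proof eventually_elim
    case (elim N)
    define t where "t = x N / sqrt (real N)"
    have t: "t < 0" "\<bar>t\<bar> < 1" "N > 0"
      using elim s by (auto simp: t_def sgn_if divide_less_0_iff split: if_splits)
    have "artanh t < 0" using artanh_pos_iff[of "- t"] t by simp
    moreover have "t ^ (p - 1) > 0" using t s by (simp add: zero_less_power_eq)
    ultimately have "\<not> artanh t / t ^ (p - 1) \<ge> 0" by (simp add: zero_le_divide_iff)
    then show ?case using mpleMean_eq[of t p] t p unfolding t_def[symmetric] by simp
  qed
  show "(\<lambda>N. ereal (real N powr (1 - real p / 2)) * mpleMean p (x N / sqrt (real N))) \<longlonglongrightarrow> \<infinity>"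
    by (rule tendsto_eventually) (use ev in eventually_elim, simp)
  show "(\<lambda>N. ereal (sqrt (real N)) * (mpleMean p (x N / sqrt (real N)) - ereal \<beta>)) \<longlonglongrightarrow> \<infinity>"
    by (rule tendsto_eventually) (use ev in eventually_elim, simp)
qed

text \<open>The delta method for artanh t / (p t^(p-1)), whose value at the peak is
  \<open>betaCW p\<close> by the critical equation. Its slope, \<open>tiltSlope\<close> over p m^p,
  becomes the curvature over p m^(p-1).\<close>

lemma near_mstar_mple:
  shows "(\<lambda>N. ereal (sqrt (real N)) * (mpleMean p (mstar p + x N / sqrt (real N)) - ereal (betaCW p)))
     \<longlonglongrightarrow> ereal (curv p / (real p * mstar p ^ (p - 1)) * s)"
    and "(\<lambda>N. ereal (real N powr (1 - real p / 2)) * mpleMean p (mstar p + x N / sqrt (real N))) \<longlonglongrightarrow> 0"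
proof -
  note P = mstar_properties[OF p]
  define m where "m = mstar p"
  have m: "0 < m" "m < 1" using P by (auto simp: m_def)
  define h where "h t = artanh t / t ^ (p - 1) / real p" for t
  define t where "t N = m + x N / sqrt (real N)" for N
  have tlim: "t \<longlonglongrightarrow> m"
    unfolding t_def using tendsto_add[OF tendsto_const div_sqrt_LIMSEQ_0[OF x]] by fastforce
  have hm: "h m = betaCW p" using P(6) p by (simp add: h_def m_def)
  have "(h has_real_derivative (tiltSlope p m / m ^ p / real p)) (at m)"
    unfolding h_def [abs_def]
    using has_real_derivative_artanh_div_power[of m p] m p by (intro DERIV_cdivide) auto
  also have "tiltSlope p m / m ^ p / real p = curv p / (real p * m ^ (p - 1))"
    using P(7) m p by (cases p) (auto simp: m_def curv_def)
  \<comment> \<open>The Caratheodory form of the derivative is an identity for every z, so the case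
    where the mean spin equals m needs no separate treatment.\<close>
  finally obtain \<rho> where \<rho>: "\<And>z. h z - h m = \<rho> z * (z - m)" "isCont \<rho> m" "\<rho> m = curv p / (real p * m ^ (p - 1))"
    using CARAT_DERIV[of h _ m] by auto
  have \<rho>lim: "(\<lambda>N. \<rho> (t N)) \<longlonglongrightarrow> curv p / (real p * m ^ (p - 1))"
    using isCont_tendsto_compose[OF \<rho>(2) tlim] \<rho>(3) by simp
  have ev: "eventually (\<lambda>N. N > 0 \<and> mpleMean p (t N) = ereal (h (t N))) sequentially"
    using order_tendstoD(1)[OF tlim m(1)] order_tendstoD(2)[OF tlim m(2)] eventually_gt_at_top[of 0]
  proof eventually_elim
    case (elim N)
    have "artanh (t N) / t N ^ (p - 1) \<ge> 0" using elim artanh_pos_iff[of "t N"] by simp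
    then show ?case using mpleMean_eq[of "t N" p] elim p by (simp add: h_def mult.commute)
  qed
  show "(\<lambda>N. ereal (sqrt (real N)) * (mpleMean p (mstar p + x N / sqrt (real N)) - ereal (betaCW p)))
     \<longlonglongrightarrow> ereal (curv p / (real p * mstar p ^ (p - 1)) * s)"
    unfolding m_def[symmetric] t_def[symmetric]
  proof (rule Lim_transform_eventually)
    show "(\<lambda>N. ereal (\<rho> (t N) * x N)) \<longlonglongrightarrow> ereal (curv p / (real p * m ^ (p - 1)) * s)"
      by (intro tendsto_ereal tendsto_mult \<rho>lim x)
    show "eventually (\<lambda>N. ereal (\<rho> (t N) * x N) = ereal (sqrt (real N)) * (mpleMean p (t N) - ereal (betaCW p))) sequentially"
      using ev
    proof eventually_elim
      case (elim N)
      have "sqrt (real N) * (h (t N) - betaCW p) = \<rho> (t N) * x N"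
        using elim \<rho>(1)[of "t N"] hm by (simp add: t_def)
      then show ?case using elim by simp
    qed
  qed
  show "(\<lambda>N. ereal (real N powr (1 - real p / 2)) * mpleMean p (mstar p + x N / sqrt (real N))) \<longlonglongrightarrow> 0"
    unfolding m_def[symmetric] t_def[symmetric] zero_ereal_def
  proof (rule Lim_transform_eventually)
    have "isCont h m" using \<open>(h has_real_derivative _) (at m)\<close> by (rule DERIV_isCont)
    then have "(\<lambda>N. h (t N)) \<longlonglongrightarrow> h m" using isCont_tendsto_compose tlim by blast
    moreover have "(\<lambda>N. real N powr (1 - real p / 2)) \<longlonglongrightarrow> 0"
      using p by (intro tendsto_neg_powr filterlim_real_sequentially) simp
    ultimately have "(\<lambda>N. real N powr (1 - real p / 2) * h (t N)) \<longlonglongrightarrow> 0"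
      using tendsto_mult by fastforce
    then show "(\<lambda>N. ereal (real N powr (1 - real p / 2) * h (t N))) \<longlonglongrightarrow> ereal 0"
      by (rule tendsto_ereal)
    show "eventually (\<lambda>N. ereal (real N powr (1 - real p / 2) * h (t N)) = ereal (real N powr (1 - real p / 2)) * mpleMean p (t N)) sequentially"
      using ev by eventually_elim simp
  qed
qed

end

subsection \<open>The limit laws\<close>

text \<open>The extended real line is compact.\<close>

lemma continuous_ereal_bounded:
  assumes "continuous_on UNIV (f :: ereal \<Rightarrow> real)"
  obtains B where "\<And>y. \<bar>f y\<bar> \<le> B"
proof -
  have "compact (range f)" by (rule compact_continuous_image[OF assms compact_UNIV])
  then obtain B where "\<forall>y\<in>range f. norm y \<le> B" using compact_imp_bounded bounded_iff by metis
  then show thesis using that by auto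
qed

lemma continuous_ereal_measurable:
  assumes "continuous_on UNIV (f :: ereal \<Rightarrow> real)"
  shows "f \<in> borel_measurable borel"
  using assms by (rule borel_measurable_continuous_onI)

text \<open>Since artanh t / t = 1 + t^2/3 + ..., the estimate is 1/2 + t^2/6 + ..., and the
  rescaled estimate tends to s^2/6. The event becomes s^2 <= 6t under the density proportional to
  exp(-s^4/12).\<close>

lemma cwP_2_LIMSEQ:
  "(\<lambda>N. cwP 2 (betaCW 2) N (\<lambda>x. ereal (sqrt (real N)) * (mple 2 N x - ereal (1/2)) \<le> ereal t))
     \<longlonglongrightarrow> (if t \<ge> 0 then Fquart (sqrt (6 * t)) - Fquart (- sqrt (6 * t)) else 0)"
proof -
  interpret peaks "gCW 2" "{0}" "\<lambda>_. 1/12" 4 by (rule peaks_gCW_2)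
  define F :: "nat \<Rightarrow> real \<Rightarrow> real" where
    "F N y = of_bool (ereal (sqrt (real N)) * (mpleMean 2 y - ereal (1/2)) \<le> ereal t)" for N y
  define G :: "real \<Rightarrow> real \<Rightarrow> real" where "G c s = of_bool (s^2 / 6 \<le> t)" for c s
  have lim: "(\<lambda>N. latticeSum (gCW 2) F N / latticeSum (gCW 2) (\<lambda>_ _. 1) N) \<longlonglongrightarrow>
    (\<Sum>c\<in>{0}. 1 / sqrt (1 - c^2) * (\<integral>s. exp (- (1/12 * s^4)) * G c s \<partial>lborel)) /
    (\<Sum>c\<in>{0}. 1 / sqrt (1 - c^2) * (\<integral>s. exp (- (1/12 * s^4)) \<partial>lborel))"
  proof (rule latticeSum_ratio)
    show "\<bar>F N y\<bar> \<le> 1" for N y by (simp add: F_def)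
    show "G c \<in> borel_measurable borel" for c unfolding G_def by measurable
    fix c :: real assume "c \<in> {0}"
    then have c: "c = 0" by simp
    have "AE s in lborel. s \<notin> {0, sqrt (6 * t), - sqrt (6 * t)}"
      by (intro AE_not_in countable_imp_null_set_lborel) auto
    then show "AE s in lborel. \<forall>x. x \<longlonglongrightarrow> s \<longrightarrow>
        (\<lambda>N. F N (c + x N * real N powr (- 1 / real 4))) \<longlonglongrightarrow> G c s"
    proof eventually_elim
      case (elim s)
      have s0: "s \<noteq> 0" using elim by simp
      have s6: "s^2 / 6 \<noteq> t"
      proof
        assume "s^2 / 6 = t"
        then have "sqrt (6 * t) = \<bar>s\<bar>" by (auto simp: real_sqrt_abs[symmetric] simp del: real_sqrt_abs)
        then show False using elim by (auto simp: abs_if split: if_splits)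
      qed
      have "(\<lambda>N. F N (x N * real N powr (- 1 / real 4))) \<longlonglongrightarrow> G 0 s" if x: "x \<longlonglongrightarrow> s" for x
      proof -
        define y where "y N = x N * real N powr (- 1 / real 4)" for N
        have "(\<lambda>N. real N powr (- 1 / real 4)) \<longlonglongrightarrow> 0"
          by (intro tendsto_neg_powr filterlim_real_sequentially) simp
        from tendsto_mult[OF x this] have y0: "y \<longlonglongrightarrow> 0" by (simp add: y_def [abs_def])
        have ev: "eventually (\<lambda>N. N > 0 \<and> y N \<noteq> 0 \<and> \<bar>y N\<bar> < 1) sequentially"
          using tendsto_imp_eventually_ne[OF x s0] tendstoD[OF y0, of 1, simplified] eventually_gt_at_top[of 0]
          by eventually_elim (auto simp: y_def)
        have "filterlim y (at 0) sequentially"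
          unfolding filterlim_at using ev y0 by (auto elim!: eventually_mono)
        moreover have "((\<lambda>t. (artanh t / t - 1) / (2 * t^2)) \<longlongrightarrow> 1/6) (at (0::real))"
        proof -
          have "((\<lambda>t. (ln ((1 + t) / (1 - t)) / 2 / t - 1) / (2 * t^2)) \<longlongrightarrow> 1/6) (at_right (0::real))" by real_asymp
          moreover have "((\<lambda>t. (ln ((1 + t) / (1 - t)) / 2 / t - 1) / (2 * t^2)) \<longlongrightarrow> 1/6) (at_left (0::real))" by real_asymp
          ultimately show ?thesis by (simp add: artanh_def filterlim_split_at)
        qed
        ultimately have "(\<lambda>N. (artanh (y N) / y N - 1) / (2 * (y N)^2)) \<longlonglongrightarrow> 1/6"
          by (rule filterlim_compose[rotated])
        from tendsto_mult[OF this tendsto_power[OF x, of 2]]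
        have lim: "(\<lambda>N. (artanh (y N) / y N - 1) / (2 * (y N)^2) * (x N)^2) \<longlonglongrightarrow> s^2 / 6" by simp
        have F: "F N (y N) = of_bool ((artanh (y N) / y N - 1) / (2 * (y N)^2) * (x N)^2 \<le> t)"
          if N: "N > 0" "y N \<noteq> 0" "\<bar>y N\<bar> < 1" for N
        proof -
          have pos: "artanh (y N) / y N > 0"
          proof (cases "y N > 0")
            case True
            then show ?thesis using artanh_pos_iff[of "y N"] N by simp
          next
            case False
            then show ?thesis using artanh_pos_iff[of "- y N"] N by (simp add: zero_less_divide_iff)
          qed
          then have "mpleMean 2 (y N) = ereal (artanh (y N) / (2 * y N))"
            using mpleMean_eq[of "y N" 2] N by simp
          \<comment> \<open>The square of the scale N^(-1/4) exactly absorbs the factor sqrt N of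
            the centering.\<close>
          moreover have "(y N)^2 * sqrt (real N) = (x N)^2"
          proof -
            have "(real N powr (- 1 / real 4))^2 = real N powr (- (1/2))"
              using N by (simp add: powr_powr flip: powr_realpow)
            also have "\<dots> = 1 / sqrt (real N)"
              using N by (simp add: powr_minus powr_half_sqrt field_simps)
            finally show ?thesis using N by (simp add: y_def power_mult_distrib)
          qed
          then have "(artanh (y N) / y N - 1) / (2 * (y N)^2) * (x N)^2
              = sqrt (real N) * (artanh (y N) / (2 * y N) - 1/2)"
            using N by (simp add: field_simps flip: \<open>(y N)^2 * sqrt (real N) = (x N)^2\<close>)
          ultimately show ?thesis by (simp add: F_def)
        qed
        have "eventually (\<lambda>N. F N (y N) = G 0 s) sequentially"
        proof (cases "s^2 / 6 < t")
          case True
          show ?thesis using ev order_tendstoD(2)[OF lim True]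
            by eventually_elim (use True in \<open>simp add: F G_def\<close>)
        next
          case False
          then have "t < s^2 / 6" using s6 by simp
          show ?thesis using ev order_tendstoD(1)[OF lim \<open>t < s^2 / 6\<close>]
            by eventually_elim (use \<open>t < s^2 / 6\<close> in \<open>simp add: F G_def\<close>)
        qed
        then show ?thesis unfolding y_def by (rule tendsto_eventually)
      qed
      then show ?case using c by simp
    qed
  qed
  have int: "integrable lborel (\<lambda>s::real. exp (- (s^4) / 12))"
    using integrable_exp_neg_even_power[of 4 "1/12"] by simp
  have eq: "(\<integral>s. exp (- (1/12 * s^4)) * G 0 s \<partial>lborel) / (\<integral>s. exp (- (1/12 * s^4)) \<partial>lborel)
      = (if t \<ge> 0 then Fquart (sqrt (6 * t)) - Fquart (- sqrt (6 * t)) else 0)"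
  proof (cases "t \<ge> 0")
    case True
    define a where "a = sqrt (6 * t)"
    have a: "a \<ge> 0" "a^2 = 6 * t" using True by (auto simp: a_def)
    have i: "integrable lborel (\<lambda>s::real. indicator {..b} s * exp (- (s^4) / 12))" for b
      using integrable_mult_indicator[OF _ int, of "{..b}"] by simp
    \<comment> \<open>The difference of two closed half-lines omits the left endpoint of the
      interval, which is a null set.\<close>
    have "AE s in lborel. s \<noteq> - a" by (rule AE_lborel_singleton)
    then have "AE s in lborel. exp (- (1/12 * s^4)) * G 0 s
      = indicator {..a} s * exp (- (s^4) / 12) - indicator {..-a} s * exp (- (s^4) / 12)"
    proof eventually_elim
      case (elim s)
      have "s^2 / 6 \<le> t \<longleftrightarrow> s^2 \<le> a^2" using a by auto
      also have "\<dots> \<longleftrightarrow> \<bar>s\<bar> \<le> a" using a abs_le_square_iff[of s a] by simp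
      finally show ?case using elim a by (auto simp: G_def indicator_def abs_le_iff)
    qed
    then have "(\<integral>s. exp (- (1/12 * s^4)) * G 0 s \<partial>lborel) =
        (\<integral>s. indicator {..a} s * exp (- (s^4) / 12) - indicator {..-a} s * exp (- (s^4) / 12) \<partial>lborel)"
      unfolding G_def by (intro integral_cong_AE) (auto simp: G_def)
    also have "\<dots> = (\<integral>s. indicator {..a} s * exp (- (s^4) / 12) \<partial>lborel) - (\<integral>s. indicator {..-a} s * exp (- (s^4) / 12) \<partial>lborel)"
      by (rule Bochner_Integration.integral_diff[OF i i])
    finally show ?thesis using True by (simp add: Fquart_def a_def diff_divide_distrib)
  next
    case False
    have "\<not> s^2 / 6 \<le> t" for s :: real using False zero_le_power2[of s] by linarith
    then show ?thesis using False by (simp add: G_def)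
  qed
  have "(\<lambda>N. latticeSum (gCW 2) F N / latticeSum (gCW 2) (\<lambda>_ _. 1) N) \<longlonglongrightarrow>
      (if t \<ge> 0 then Fquart (sqrt (6 * t)) - Fquart (- sqrt (6 * t)) else 0)"
    using lim eq by simp
  then show ?thesis
  proof (rule Lim_transform_eventually)
    show "eventually (\<lambda>N. latticeSum (gCW 2) F N / latticeSum (gCW 2) (\<lambda>_ _. 1) N =
       cwP 2 (betaCW 2) N (\<lambda>x. ereal (sqrt (real N)) * (mple 2 N x - ereal (1/2)) \<le> ereal t)) sequentially"
      using eventually_gt_at_top[of 0]
    proof eventually_elim
      case (elim N)
      show ?case unfolding cwP_def
        by (rule cwE_eq_latticeSum_ratio[symmetric]) (use elim in \<open>auto simp: F_def mple_eq_mpleMean\<close>)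
    qed
  qed
qed

section \<open>Limit laws for p at least 3\<close>

lemma integral_std_normal_eq:
  assumes [measurable]: "\<phi> \<in> borel_measurable borel"
  shows "(\<integral>s. exp (- (1 / 2 * s^2)) * \<phi> s \<partial>lborel) / sqrt (2 * pi)
     = (\<integral>z. \<phi> z \<partial>density lborel std_normal_density)"
  using integral_exp_square_substitution[of 1 1 \<phi>]
  by (subst integral_real_density) (auto simp: mult.commute)

text \<open>At the peak 0 both signs of s lead to infinity, so the test function contributes the
  constant f at infinity; the nonzero peaks contribute a linear image of a Gaussian.\<close>

lemma cw_conv_distr_centered:
  assumes p: "p \<ge> 3"
  shows "cw_conv_distr p (betaCW p)
         (\<lambda>N x. ereal (sqrt (real N)) * (mple p N x - ereal (betaCW p)))
         (\<lambda>f. (1 - alphaCW p) *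
               (\<integral>z. f (ereal z) \<partial>(density lborel (normal_density 0
                  (sqrt (- deriv (deriv (gCW p)) (mstar p)
                          / ((real p)\<^sup>2 * mstar p ^ (2 * p - 2)))))))
             + alphaCW p * f \<infinity>)"
  unfolding cw_conv_distr_def
proof (intro allI impI)
  fix f :: "ereal \<Rightarrow> real" assume f: "continuous_on UNIV f"
  note P = mstar_properties[OF p]
  obtain B where B: "\<And>y. \<bar>f y\<bar> \<le> B" using continuous_ereal_bounded[OF f] by blast
  note [measurable] = continuous_ereal_measurable[OF f]
  have fl: "(\<lambda>N. f (Y N)) \<longlonglongrightarrow> f L" if "Y \<longlonglongrightarrow> L" for Y :: "nat \<Rightarrow> ereal" and L
    using continuous_on_tendsto_compose[OF f that] by simp
  \<comment> \<open>The slope of the estimate as a function of the mean spin at the peak; divided by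
    \<open>sqrt (curv p)\<close> it is the standard deviation of the limit.\<close>
  define \<kappa> where "\<kappa> = curv p / (real p * mstar p ^ (p - 1))"
  have v: "curv p > 0" using P(5) by (simp add: curv_def)
  have \<kappa>: "\<kappa> > 0" using v P p by (simp add: \<kappa>_def)
  define H where "H N b = f (ereal (sqrt (real N)) * (b - ereal (betaCW p)))" for N :: nat and b
  have lim: "(\<lambda>N. cwE p (betaCW p) N (\<lambda>x. H N (mple p N x))) \<longlonglongrightarrow>
      alphaCW p * ((\<integral>s. exp (- (1 / 2 * s^2)) * f \<infinity> \<partial>lborel) / sqrt (2 * pi)) +
      (1 - alphaCW p) * ((\<integral>s. exp (- (curv p / 2 * s^2)) * f (ereal (\<kappa> * s)) \<partial>lborel) / sqrt (2 * pi / curv p))"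
  proof (rule cwE_mple_LIMSEQ[OF p])
    show "\<bar>H N b\<bar> \<le> B" for N b by (simp add: H_def B)
    show "(\<lambda>N. H N (mpleMean p (x N / sqrt (real N)))) \<longlonglongrightarrow> f \<infinity>" if s: "s \<noteq> 0" and x: "x \<longlonglongrightarrow> s" for x s
    proof (cases "s > 0 \<or> even p")
      case True
      show ?thesis unfolding H_def by (intro fl near_zero_mple(2)[OF p x s True])
    next
      case False
      then show ?thesis unfolding H_def using s by (intro fl near_zero_mple_negative(2)[OF p x]) auto
    qed
    show "(\<lambda>N. H N (mpleMean p (mstar p + x N / sqrt (real N)))) \<longlonglongrightarrow> f (ereal (\<kappa> * s))" if x: "x \<longlonglongrightarrow> s" for x s
      unfolding H_def \<kappa>_def by (intro fl near_mstar_mple(1)[OF p x])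
  qed measurable
  have const: "(\<integral>s. exp (- (1 / 2 * s^2)) * f \<infinity> \<partial>lborel) / sqrt (2 * pi) = f \<infinity>"
    using integral_exp_square[of 1] by simp
  have gauss: "(\<integral>s. exp (- (curv p / 2 * s^2)) * f (ereal (\<kappa> * s)) \<partial>lborel) / sqrt (2 * pi / curv p)
     = (\<integral>z. f (ereal z) \<partial>(density lborel (normal_density 0
                  (sqrt (- deriv (deriv (gCW p)) (mstar p)
                          / ((real p)\<^sup>2 * mstar p ^ (2 * p - 2)))))))"
  proof -
    have "mstar p ^ (2 * p - 2) = (mstar p ^ (p - 1))^2"
    proof -
      have "2 * p - 2 = (p - 1) * 2" by simp
      then show ?thesis by (simp only: power_mult)
    qed
    then have "sqrt (- deriv (deriv (gCW p)) (mstar p) / ((real p)\<^sup>2 * mstar p ^ (2 * p - 2)))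
       = sqrt (curv p) / (real p * mstar p ^ (p - 1))"
      unfolding curv_def[symmetric] using P(1) by (simp add: real_sqrt_divide real_sqrt_mult)
    also have "\<dots> = \<kappa> / sqrt (curv p)"
    proof -
      have "\<kappa> / sqrt (curv p) = curv p / sqrt (curv p) / (real p * mstar p ^ (p - 1))"
        by (simp add: \<kappa>_def mult_ac)
      then show ?thesis using v by (simp add: real_div_sqrt)
    qed
    finally have \<sigma>: "sqrt (- deriv (deriv (gCW p)) (mstar p) / ((real p)\<^sup>2 * mstar p ^ (2 * p - 2)))
       = \<kappa> / sqrt (curv p)" .
    have "(\<integral>z. f (ereal z) \<partial>(density lborel (normal_density 0 (\<kappa> / sqrt (curv p)))))
       = (\<integral>z. normal_density 0 (\<kappa> / sqrt (curv p)) z * f (ereal z) \<partial>lborel)"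
      by (subst integral_real_density) auto
    then show ?thesis
      unfolding \<sigma> integral_exp_square_substitution[OF v \<kappa>, of "\<lambda>z. f (ereal z)"] using v by simp
  qed
  show "(\<lambda>N. cwE p (betaCW p) N (\<lambda>x. f (ereal (sqrt (real N)) * (mple p N x - ereal (betaCW p)))))
     \<longlonglongrightarrow> (1 - alphaCW p) *
               (\<integral>z. f (ereal z) \<partial>(density lborel (normal_density 0
                  (sqrt (- deriv (deriv (gCW p)) (mstar p)
                          / ((real p)\<^sup>2 * mstar p ^ (2 * p - 2)))))))
             + alphaCW p * f \<infinity>"
    using lim unfolding const gauss H_def by (subst add.commute)
qed

text \<open>The conditional integrand serves both parities: for odd p the negative side of the peak
  at 0 gives an infinite estimate. Near the nonzero peaks the estimate stays bounded and the
  vanishing factor N^(1-p/2) sends it to 0.\<close>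

lemma cw_conv_distr_scaled:
  assumes p: "p \<ge> 3" and f: "continuous_on UNIV (f :: ereal \<Rightarrow> real)"
  shows "(\<lambda>N. cwE p (betaCW p) N (\<lambda>x. f (ereal (real N powr (1 - real p / 2)) * mple p N x))) \<longlonglongrightarrow>
     alphaCW p * (\<integral>z. (if z > 0 \<or> even p then f (ereal (1 / (real p * z ^ (p - 2)))) else f \<infinity>)
        \<partial>density lborel std_normal_density)
     + (1 - alphaCW p) * f 0"
proof -
  note P = mstar_properties[OF p]
  obtain B where B: "\<And>y. \<bar>f y\<bar> \<le> B" using continuous_ereal_bounded[OF f] by blast
  note [measurable] = continuous_ereal_measurable[OF f]
  have fl: "(\<lambda>N. f (Y N)) \<longlonglongrightarrow> f L" if "Y \<longlonglongrightarrow> L" for Y :: "nat \<Rightarrow> ereal" and L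
    using continuous_on_tendsto_compose[OF f that] by simp
  have v: "curv p > 0" using P(5) by (simp add: curv_def)
  define H where "H N b = f (ereal (real N powr (1 - real p / 2)) * b)" for N :: nat and b
  define G where "G s = (if s > 0 \<or> even p then f (ereal (1 / (real p * s ^ (p - 2)))) else f \<infinity>)" for s
  have G [measurable]: "G \<in> borel_measurable borel" unfolding G_def by measurable
  have lim: "(\<lambda>N. cwE p (betaCW p) N (\<lambda>x. H N (mple p N x))) \<longlonglongrightarrow>
      alphaCW p * ((\<integral>s. exp (- (1 / 2 * s^2)) * G s \<partial>lborel) / sqrt (2 * pi)) +
      (1 - alphaCW p) * ((\<integral>s. exp (- (curv p / 2 * s^2)) * f 0 \<partial>lborel) / sqrt (2 * pi / curv p))"
  proof (rule cwE_mple_LIMSEQ[OF p])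
    show "\<bar>H N b\<bar> \<le> B" for N b by (simp add: H_def B)
    show "(\<lambda>N. H N (mpleMean p (x N / sqrt (real N)))) \<longlonglongrightarrow> G s" if s: "s \<noteq> 0" and x: "x \<longlonglongrightarrow> s" for x s
    proof (cases "s > 0 \<or> even p")
      case True
      have "(\<lambda>N. H N (mpleMean p (x N / sqrt (real N)))) \<longlonglongrightarrow> f (ereal (1 / (real p * s ^ (p - 2))))"
        unfolding H_def by (intro fl near_zero_mple(1)[OF p x s True])
      then show ?thesis using True by (simp add: G_def)
    next
      case False
      have "(\<lambda>N. H N (mpleMean p (x N / sqrt (real N)))) \<longlonglongrightarrow> f \<infinity>"
        unfolding H_def using s False by (intro fl near_zero_mple_negative(1)[OF p x]) auto
      then show ?thesis using False by (auto simp: G_def)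
    qed
    show "(\<lambda>N. H N (mpleMean p (mstar p + x N / sqrt (real N)))) \<longlonglongrightarrow> f 0" if x: "x \<longlonglongrightarrow> s" for x s
      unfolding H_def by (intro fl near_mstar_mple(2)[OF p x])
  qed measurable
  have const: "(\<integral>s. exp (- (curv p / 2 * s^2)) * f 0 \<partial>lborel) / sqrt (2 * pi / curv p) = f 0"
    using integral_exp_square[OF v] v by simp
  show ?thesis
    using lim unfolding integral_std_normal_eq[OF G] const unfolding H_def G_def .
qed

text \<open>The integrand and its mirror image have the same integral, and off 0 they add up to
  \<open>\<phi> \<bar>z\<bar> + a\<close>. This turns the one-sided limit for odd p into the two
  halves stated with the law of |Z|.\<close>

lemma integral_std_normal_half:
  fixes a :: real
  assumes [measurable]: "\<phi> \<in> borel_measurable borel" and B: "\<And>z. \<bar>\<phi> z\<bar> \<le> B"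
  shows "(\<integral>z. (if z > 0 then \<phi> \<bar>z\<bar> else a) \<partial>density lborel std_normal_density)
     = (\<integral>z. \<phi> \<bar>z\<bar> \<partial>density lborel std_normal_density) / 2 + a / 2"
proof -
  let ?M = "density lborel std_normal_density"
  interpret prob_space ?M by (rule prob_space_normal_density) simp
  define f1 where "f1 z = (if z > 0 then \<phi> \<bar>z\<bar> else a)" for z
  define f2 where "f2 z = (if z < 0 then \<phi> \<bar>z\<bar> else a)" for z
  have m [measurable]: "f1 \<in> borel_measurable borel" "f2 \<in> borel_measurable borel"
    unfolding f1_def f2_def by measurable
  have "\<bar>f1 z\<bar> \<le> max B \<bar>a\<bar>" "\<bar>f2 z\<bar> \<le> max B \<bar>a\<bar>" for z
    using B by (auto simp: f1_def f2_def intro: max.coboundedI1)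
  then have i: "integrable ?M f1" "integrable ?M f2"
    by (auto intro!: integrable_const_bound[where B = "max B \<bar>a\<bar>"])
  have i': "integrable ?M (\<lambda>z. \<phi> \<bar>z\<bar>)"
    using B by (auto intro!: integrable_const_bound[where B = B])
  have refl: "integral\<^sup>L ?M f2 = integral\<^sup>L ?M f1"
  proof -
    have "integral\<^sup>L ?M f2 = (\<integral>z. std_normal_density z * f2 z \<partial>lborel)"
      by (subst integral_real_density) auto
    also have "\<dots> = (\<integral>z. std_normal_density (- z) * f2 (- z) \<partial>lborel)"
      by (rule integral_reflect_real[symmetric])
    also have "\<dots> = (\<integral>z. std_normal_density z * f1 z \<partial>lborel)"
    proof -
      have "f2 (- z) = f1 z" for z by (auto simp: f1_def f2_def)
      then show ?thesis by (simp add: normal_density_def)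
    qed
    also have "\<dots> = integral\<^sup>L ?M f1"
      by (subst integral_real_density) auto
    finally show ?thesis .
  qed
  have "AE z in lborel. z \<noteq> (0::real)" by (rule AE_lborel_singleton)
  then have ae: "AE z in ?M. f1 z + f2 z = \<phi> \<bar>z\<bar> + a"
    by (subst AE_density) (auto elim!: eventually_mono simp: f1_def f2_def)
  have "2 * integral\<^sup>L ?M f1 = (\<integral>z. f1 z + f2 z \<partial>?M)"
    using i refl by simp
  also have "\<dots> = (\<integral>z. \<phi> \<bar>z\<bar> + a \<partial>?M)"
    by (rule integral_cong_AE[OF _ _ ae]) measurable
  also have "\<dots> = (\<integral>z. \<phi> \<bar>z\<bar> \<partial>?M) + a"
    using i' prob_space by simp
  finally have "integral\<^sup>L ?M f1 = (\<integral>z. \<phi> \<bar>z\<bar> \<partial>?M) / 2 + a / 2" by simp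
  then show ?thesis unfolding f1_def .
qed

theorem mainTheorem18:
  fixes p :: nat
  assumes "p \<ge> 2"
  shows
   "(p = 2 \<longrightarrow> (\<forall>t::real.
       (\<lambda>N. cwP p (betaCW p) N
          (\<lambda>x. ereal (sqrt (real N)) * (mple p N x - ereal (1/2)) \<le> ereal t))
       \<longlonglongrightarrow> (if t \<ge> 0 then Fquart (sqrt (6 * t)) - Fquart (- sqrt (6 * t)) else 0)))
  \<and> (p \<ge> 3 \<longrightarrow>
       cw_conv_distr p (betaCW p)
         (\<lambda>N x. ereal (sqrt (real N)) * (mple p N x - ereal (betaCW p)))
         (\<lambda>f. (1 - alphaCW p) *
               (\<integral>z. f (ereal z) \<partial>(density lborel (normal_density 0
                  (sqrt (- deriv (deriv (gCW p)) (mstar p)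
                          / ((real p)\<^sup>2 * mstar p ^ (2 * p - 2)))))))
             + alphaCW p * f \<infinity>))
  \<and> (even p \<and> p \<ge> 4 \<longrightarrow>
       cw_conv_distr p (betaCW p)
         (\<lambda>N x. ereal (real N powr (1 - real p / 2)) * mple p N x)
         (\<lambda>f. alphaCW p *
               (\<integral>z. f (ereal (1 / (real p * z ^ (p - 2)))) \<partial>(density lborel std_normal_density))
             + (1 - alphaCW p) * f 0))
  \<and> (odd p \<longrightarrow>
       cw_conv_distr p (betaCW p)
         (\<lambda>N x. ereal (real N powr (1 - real p / 2)) * mple p N x)
         (\<lambda>f. alphaCW p / 2 *
               (\<integral>z. f (ereal (1 / (real p * \<bar>z\<bar> ^ (p - 2)))) \<partial>(density lborel std_normal_density))
             + alphaCW p / 2 * f \<infinity>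
             + (1 - alphaCW p) * f 0))"
proof (intro conjI impI allI)
  fix t :: real
  assume "p = 2"
  then show "(\<lambda>N. cwP p (betaCW p) N
          (\<lambda>x. ereal (sqrt (real N)) * (mple p N x - ereal (1/2)) \<le> ereal t))
       \<longlonglongrightarrow> (if t \<ge> 0 then Fquart (sqrt (6 * t)) - Fquart (- sqrt (6 * t)) else 0)"
    using cwP_2_LIMSEQ[of t] by simp
next
  assume "p \<ge> 3"
  then show "cw_conv_distr p (betaCW p)
         (\<lambda>N x. ereal (sqrt (real N)) * (mple p N x - ereal (betaCW p)))
         (\<lambda>f. (1 - alphaCW p) *
               (\<integral>z. f (ereal z) \<partial>(density lborel (normal_density 0
                  (sqrt (- deriv (deriv (gCW p)) (mstar p)
                          / ((real p)\<^sup>2 * mstar p ^ (2 * p - 2)))))))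
             + alphaCW p * f \<infinity>)"
    by (rule cw_conv_distr_centered)
next
  assume "even p \<and> p \<ge> 4"
  then have "even p" "p \<ge> 3" by auto
  then show "cw_conv_distr p (betaCW p)
         (\<lambda>N x. ereal (real N powr (1 - real p / 2)) * mple p N x)
         (\<lambda>f. alphaCW p *
               (\<integral>z. f (ereal (1 / (real p * z ^ (p - 2)))) \<partial>(density lborel std_normal_density))
             + (1 - alphaCW p) * f 0)"
    unfolding cw_conv_distr_def using cw_conv_distr_scaled[OF \<open>p \<ge> 3\<close>] by simp
next
  assume "odd p"
  then have p: "p \<ge> 3" using assms by (cases "p = 2") auto
  show "cw_conv_distr p (betaCW p)
         (\<lambda>N x. ereal (real N powr (1 - real p / 2)) * mple p N x)
         (\<lambda>f. alphaCW p / 2 *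
               (\<integral>z. f (ereal (1 / (real p * \<bar>z\<bar> ^ (p - 2)))) \<partial>(density lborel std_normal_density))
             + alphaCW p / 2 * f \<infinity>
             + (1 - alphaCW p) * f 0)"
    unfolding cw_conv_distr_def
  proof (intro allI impI)
    fix f :: "ereal \<Rightarrow> real" assume f: "continuous_on UNIV f"
    note [measurable] = continuous_ereal_measurable[OF f]
    obtain B where B: "\<And>y. \<bar>f y\<bar> \<le> B" using continuous_ereal_bounded[OF f] by blast
    define \<phi> where "\<phi> z = f (ereal (1 / (real p * z ^ (p - 2))))" for z
    have half: "(\<integral>z. (if z > 0 then \<phi> \<bar>z\<bar> else f \<infinity>) \<partial>density lborel std_normal_density)
       = (\<integral>z. \<phi> \<bar>z\<bar> \<partial>density lborel std_normal_density) / 2 + f \<infinity> / 2"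
      by (rule integral_std_normal_half[of _ B]) (auto simp: \<phi>_def B)
    \<comment> \<open>On z > 0 the absolute value changes nothing; it is inserted so that the
      half-line formula applies.\<close>
    have "(\<lambda>z. if z > 0 \<or> even p then f (ereal (1 / (real p * z ^ (p - 2)))) else f \<infinity>)
        = (\<lambda>z. if z > 0 then \<phi> \<bar>z\<bar> else f \<infinity>)"
      using \<open>odd p\<close> by (auto simp: \<phi>_def)
    then show "(\<lambda>N. cwE p (betaCW p) N (\<lambda>x. f (ereal (real N powr (1 - real p / 2)) * mple p N x))) \<longlonglongrightarrow>
        alphaCW p / 2 *
               (\<integral>z. f (ereal (1 / (real p * \<bar>z\<bar> ^ (p - 2)))) \<partial>(density lborel std_normal_density))
             + alphaCW p / 2 * f \<infinity>
             + (1 - alphaCW p) * f 0"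
      using cw_conv_distr_scaled[OF p f] half by (simp add: \<phi>_def algebra_simps)
  qed
qed

end
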